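(* Let $E$ be a complex separable Hilbert space, let $(\lambda_i)_{i=1}^{d}\subset\mathbb{D}$ and let $(W_i)_{i=1}^{d}\subset\mathcal{L}(E)$ be such that $W_j^{*}W_i=W_iW_j^{*}$ for $1\le i,j\le d$. Then the following are equivalent: (1) There exists a function $\Phi\in H^{\infty}(\mathcal{L}(E))$ such that $\Phi(\lambda_i)=W_i$ for $1\le i\le d$, and $\|\Phi\|_{\infty}\le 1$. (2) The block matrix $$P=\Big[\frac{I-W_i^{*}W_j}{1-\overline{\lambda_i}\lambda_j}\Big]_{i,j=1}^{d}$$ is positive definite (in the sense $P\ge 0$).
   Context: $\mathbb{D}$ is the open unit disk, $\mathbb{T}$ the unit circle, $\mathcal{L}(E)$ the algebra of bounded linear operators on $E$, and $I$ the identity of $E$. $L^{2}(\mathcal{L}(E))$ is the set of functions $\Phi(z)=\sum_{n\in\mathbb{Z}}A_nz^n$ on $\mathbb{T}$ with $A_n\in\mathcal{L}(E)$ and $\sum_n\|A_n\|^2<\infty$; $H^{2}(\mathcal{L}(E))$ consists of those with $A_n=0$ for $n\le -1$; $H^{\infty}(\mathcal{L}(E))$ is the space of bounded functions in $H^2(\mathcal{L}(E))$, identified with bounded analytic $\mathcal{L}(E)$-valued functions on $\mathbb{D}$, with supremum norm $\|\cdot\|_\infty$. Throughout, "positive definite" is used in the non-strict sense $\ge 0$: a block operator matrix $P=[P_{ij}]_{i,j=1}^d$ with entries in $\mathcal{L}(E)$, acting on $E\oplus\cdots\oplus E$ ($d$ copies), is positive definite if $\sum_{i,j=1}^{d}\langle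 P_{ij}x_j,x_i\rangle_E\ge 0$ for all $x_1,\dots,x_d\in E$. *)

theory Defs
  imports "HOL-Analysis.Analysis"
begin

class scaleC =
  fixes scaleC :: "complex \<Rightarrow> 'a \<Rightarrow> 'a"  (infixr "*\<^sub>C" 75)

text \<open>
  Complex Hilbert spaces. The underlying real Hilbert space, whose inner product is the real part
  of the complex one, is kept as part of the structure, so that the library theory of normed
  and real inner product spaces and of \<^typ>\<open>'a \<Rightarrow>\<^sub>L 'b\<close> applies. Definiteness of \<open>cinner\<close>
  and the identity \<open>cinner x x = (norm x)\<^sup>2\<close> follow from \<open>cinner_commute\<close> and \<open>inner_eq_Re_cinner\<close>.
  The inner product is linear in its first argument.
\<close>

class complex_hilbert = real_inner + banach + scaleC +
  fixes cinner :: "'a \<Rightarrow> 'a \<Rightarrow> complex"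
  assumes scaleC_add_right: "c *\<^sub>C (x + y) = c *\<^sub>C x + c *\<^sub>C y"
    and scaleC_add_left: "(b + c) *\<^sub>C x = b *\<^sub>C x + c *\<^sub>C x"
    and scaleC_scaleC: "b *\<^sub>C c *\<^sub>C x = (b * c) *\<^sub>C x"
    and scaleR_eq_scaleC: "r *\<^sub>R x = complex_of_real r *\<^sub>C x"
    and cinner_add_left: "cinner (x + y) z = cinner x z + cinner y z"
    and cinner_scaleC_left: "cinner (c *\<^sub>C x) y = c * cinner x y"
    and cinner_commute: "cinner x y = cnj (cinner y x)"
    and inner_eq_Re_cinner: "inner x y = Re (cinner x y)"
begin

lemma cinner_self: "cinner x x = complex_of_real ((norm x)\<^sup>2)"
proof (rule complex_eqI)
  show "Re (cinner x x) = Re (complex_of_real ((norm x)\<^sup>2))"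
    by (simp add: inner_eq_Re_cinner[symmetric] power2_norm_eq_inner)
  show "Im (cinner x x) = Im (complex_of_real ((norm x)\<^sup>2))"
    using arg_cong[OF cinner_commute[of x x], of Im] by simp
qed

lemma cinner_scaleC_right: "cinner x (c *\<^sub>C y) = cnj c * cinner x y"
  by (metis cinner_commute cinner_scaleC_left complex_cnj_mult)

lemma norm_scaleC: "norm (c *\<^sub>C x) = cmod c * norm x"
proof -
  have "complex_of_real ((norm (c *\<^sub>C x))\<^sup>2) = c * cnj c * cinner x x"
    unfolding cinner_self[symmetric] cinner_scaleC_left cinner_scaleC_right by simp
  also have "\<dots> = complex_of_real ((cmod c * norm x)\<^sup>2)"
    by (simp add: cinner_self complex_norm_square[symmetric] power_mult_distrib)
  finally have "(norm (c *\<^sub>C x))\<^sup>2 = (cmod c * norm x)\<^sup>2"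
    using of_real_eq_iff by blast
  then show ?thesis by simp
qed

end

lemma bounded_linear_scaleC: "bounded_linear (\<lambda>x::'a::complex_hilbert. c *\<^sub>C x)"
proof (rule bounded_linear_intro)
  show "c *\<^sub>C (r *\<^sub>R x) = r *\<^sub>R (c *\<^sub>C x)" for r and x :: 'a
    by (simp add: scaleR_eq_scaleC scaleC_scaleC mult.commute)
  show "norm (c *\<^sub>C x) \<le> norm x * cmod c" for x :: 'a
    by (simp add: norm_scaleC mult.commute)
qed (simp add: scaleC_add_right)

instantiation complex :: complex_hilbert
begin

definition scaleC_complex :: "complex \<Rightarrow> complex \<Rightarrow> complex"
  where "scaleC_complex c z = c * z"

definition cinner_complex :: "complex \<Rightarrow> complex \<Rightarrow> complex"
  where "cinner_complex z w = z * cnj w"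

instance
  by standard
    (simp_all add: scaleC_complex_def cinner_complex_def algebra_simps scaleR_conv_of_real
      inner_complex_def)

end

instantiation blinfun :: (real_normed_vector, complex_hilbert) scaleC
begin

lift_definition scaleC_blinfun :: "complex \<Rightarrow> ('a \<Rightarrow>\<^sub>L 'b) \<Rightarrow> 'a \<Rightarrow>\<^sub>L 'b"
  is "\<lambda>c A x. c *\<^sub>C A x"
  by (rule bounded_linear_compose[OF bounded_linear_scaleC])

instance ..

end

text \<open>
  The type \<^typ>\<open>'a \<Rightarrow>\<^sub>L 'a\<close> consists of the bounded \<^emph>\<open>real\<close>-linear operators; the algebra
  $\mathcal{L}(E)$ is its subset of complex-linear ones, with the same operator norm.
\<close>

definition bounded_clinear_ops :: "('a::complex_hilbert \<Rightarrow>\<^sub>L 'a) set"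
  where "bounded_clinear_ops = {A. \<forall>c x. blinfun_apply A (c *\<^sub>C x) = c *\<^sub>C blinfun_apply A x}"

text \<open>
  The Hilbert space adjoint; for \<open>A \<in> bounded_clinear_ops\<close> it exists by the Riesz representation
  theorem, and it is unique by \<open>cadjoint_unique\<close> below.
\<close>

definition cadjoint :: "('a::complex_hilbert \<Rightarrow>\<^sub>L 'a) \<Rightarrow> 'a \<Rightarrow>\<^sub>L 'a"
  where "cadjoint A = (THE B. \<forall>x y. cinner (blinfun_apply A x) y = cinner x (blinfun_apply B y))"

lemma cadjoint_unique:
  fixes A B :: "'a::complex_hilbert \<Rightarrow>\<^sub>L 'a"
  assumes "\<And>x y. cinner (A x) y = cinner x (B y)"
  shows "cadjoint A = B"
  unfolding cadjoint_def
proof (rule the_equality)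
  show "\<forall>x y. cinner (A x) y = cinner x (B y)" using assms by simp
  fix C :: "'a \<Rightarrow>\<^sub>L 'a"
  assume C: "\<forall>x y. cinner (A x) y = cinner x (C y)"
  show "C = B"
  proof (rule blinfun_eqI)
    fix y
    have "inner x (C y) = inner x (B y)" for x
      using C assms by (simp add: inner_eq_Re_cinner)
    then show "C y = B y"
      by (metis inner_diff_right inner_eq_zero_iff right_minus_eq)
  qed
qed

text \<open>
  $H^\infty(\mathcal{L}(E))$, realised as the bounded analytic functions on the open unit disk:
  $\Phi(z) = \sum_{n \ge 0} z^n A_n$ with $A_n \in \mathcal{L}(E)$, the series converging in operator
  norm for $|z| < 1$. No condition $\sum_n \|A_n\|^2 < \infty$ is imposed: for infinite-dimensional $E$
  it fails for some bounded analytic functions, such as $\mathrm{diag}(z^n)_{n \ge 0}$.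
  Values outside the disk are irrelevant. The supremum in \<open>Hinf_norm\<close> is meaningful for members of \<open>Hinf\<close> only.
\<close>

definition Hinf :: "(complex \<Rightarrow> 'a::complex_hilbert \<Rightarrow>\<^sub>L 'a) set"
  where "Hinf = {\<Phi>.
    (\<exists>A :: nat \<Rightarrow> 'a \<Rightarrow>\<^sub>L 'a. (\<forall>n. A n \<in> bounded_clinear_ops) \<and>
       (\<forall>z\<in>ball 0 1. (\<lambda>n. z ^ n *\<^sub>C A n) sums \<Phi> z)) \<and>
    bounded (\<Phi> ` ball 0 1)}"

definition Hinf_norm :: "(complex \<Rightarrow> 'a::complex_hilbert \<Rightarrow>\<^sub>L 'a) \<Rightarrow> real"
  where "Hinf_norm \<Phi> = (SUP z\<in>ball 0 1. norm (\<Phi> z))"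

text \<open>
  Positivity (in the non-strict sense) of the $d \times d$ block operator matrix
  $[P_{ij}]_{i,j=1}^d$; membership in \<open>\<real>\<^sub>\<ge>\<^sub>0\<close> includes that the complex number is real.
\<close>

definition block_positive :: "nat \<Rightarrow> (nat \<Rightarrow> nat \<Rightarrow> 'a::complex_hilbert \<Rightarrow>\<^sub>L 'a) \<Rightarrow> bool"
  where "block_positive d P \<longleftrightarrow>
    (\<forall>x :: nat \<Rightarrow> 'a. (\<Sum>i\<in>{1..d}. \<Sum>j\<in>{1..d}. cinner (P i j (x j)) (x i)) \<in> \<real>\<^sub>\<ge>\<^sub>0)"

end

theory Submission
  imports Defs
begin

text \<open>
  Both directions rest on one identity. Expanding
  $1 / (1 - \overline{\lambda_i} \lambda_j)$ into a geometric series, the quadratic form of the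
  Pick matrix at $x_1, \dots, x_d$ becomes
  $\sum_{m \ge 0} (\|y_m\|^2 - \|w_m\|^2)$ with $y_m = \sum_j \lambda_j^m x_j$ and
  $w_m = \sum_j \lambda_j^m W_j x_j$ (\<open>szego_form_sums\<close>, \<open>cinner_pick_entry\<close>).

  \<^bold>\<open>Necessity.\<close> If $\Phi(z) = \sum_n z^n A_n$ interpolates, then $w_m = \sum_n A_n y_{m+n}$, so
  that $w$ is the image of $y$ under an upper triangular block Toeplitz operator. Read from its last
  entry backwards, a finite section of it multiplies polynomials by $\Phi$ and drops the high
  coefficients. By Parseval's identity and $\|\Phi\| \le 1$ this does not increase the norm, whence
  $\sum \|w_m\|^2 \le \sum \|y_m\|^2$ (\<open>contractive_symbol_toeplitz\<close>). Since only polynomials are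
  involved, Parseval's identity is used with averages over roots of unity in place of integrals
  (\<open>parseval_roots_of_unity\<close>).

  \<^bold>\<open>Sufficiency\<close> is a lurking isometry argument. Write $P = R^* R$ with $R$ mapping $E^d$ into
  a Hilbert space $K$. With $x$ ranging over $E^d$ and $\Lambda = \mathrm{diag}(\lambda_j)$, the
  definition of $P$ says that
  \<^item> $\|\sum_j x_j\|^2 + \|R \Lambda x\|^2 = \|\sum_j W_j x_j\|^2 + \|R x\|^2$,

  so $(\sum_j x_j, R \Lambda x) \mapsto (\sum_j W_j x_j, R x)$ is isometric, and it extends to a
  contraction
  $T = (A, B; C, D)$ on $E \oplus K$ (\<open>contraction_factorization\<close>). Its transfer function
  $\Phi(z) = A + z B (I - z D)^{-1} C$ is bounded by $1$ on the disk, because $T$ is a contraction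
  (\<open>transfer_function_Hinf\<close>). If only $x_i$ is nonzero, the relation
  $T (x_i, \lambda_i R x) = (W_i x_i, R x)$ reads $\Phi(\lambda_i) x_i = W_i x_i$.

  The factorization of $P$ is obtained without a square root. If $0 \le P \le I$, then the
  recursion $P_0 = P$, $P_{n+1} = P_n - P_n^2$ preserves these bounds, and telescoping gives
  $\langle P x, x \rangle = \sum_n \|P_n x\|^2$; so $R x = (P_n x)_n$ is an element of $\ell^2$
  (\<open>positive_operator_factorization\<close>). The spaces are therefore all instances of
  one type constructor of square-summable sequences: $E^d$ lives in $\ell^2(E)$, and
  $E \oplus K$ in $\ell^2(\ell^2(E))$, where $E$ is placed in the zeroth entry of the zeroth entry
  and $K$ is its orthogonal complement.
\<close>

section \<open>Calculus in complex Hilbert spaces\<close>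

lemma scaleC_one [simp]: "1 *\<^sub>C x = (x::'a::complex_hilbert)"
  using scaleR_eq_scaleC[of 1 x] by simp

lemma scaleC_zero_right [simp]: "c *\<^sub>C 0 = (0::'a::complex_hilbert)"
  using bounded_linear_scaleC linear_0 bounded_linear.linear by blast

lemma scaleC_diff_right: "c *\<^sub>C (x - y) = c *\<^sub>C x - c *\<^sub>C (y::'a::complex_hilbert)"
  by (simp add: bounded_linear_scaleC bounded_linear.linear linear_diff)

lemma scaleC_sum_right: "c *\<^sub>C (\<Sum>i\<in>I. f i) = (\<Sum>i\<in>I. c *\<^sub>C (f i :: 'a::complex_hilbert))"
  by (simp add: bounded_linear_scaleC bounded_linear.linear linear_sum)

lemma scaleC_scaleR_commute: "c *\<^sub>C (r *\<^sub>R x) = r *\<^sub>R (c *\<^sub>C (x::'a::complex_hilbert))"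
  by (simp add: bounded_linear_scaleC bounded_linear.linear linear_cmul)

lemma cinner_add_right: "cinner x (y + z) = cinner x y + cinner (x::'a::complex_hilbert) z"
  by (metis cinner_add_left cinner_commute complex_cnj_add)

lemma cinner_scaleR_left: "cinner (r *\<^sub>R x) y = of_real r * cinner x (y::'a::complex_hilbert)"
  by (simp add: scaleR_eq_scaleC cinner_scaleC_left)

text \<open>
  The imaginary part of the complex inner product is the real one against a rotated vector, so
  real identities between complex-linear expressions carry over to \<open>cinner\<close>.
\<close>

lemma cinner_conv_inner:
  "cinner x y = Complex (inner x y) (inner (- \<i> *\<^sub>C x) (y::'a::complex_hilbert))"
  by (rule complex_eqI) (simp_all add: inner_eq_Re_cinner cinner_scaleC_left)

lemma norm_cinner_le: "norm (cinner x y) \<le> norm x * norm (y::'a::complex_hilbert)"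
proof (cases "cinner x y = 0")
  case False
  \<comment> \<open>The unimodular factor that rotates the inner product to its modulus.\<close>
  define c where "c = cnj (cinner x y) / norm (cinner x y)"
  have c: "norm c = 1" using False by (simp add: c_def norm_divide)
  have "of_real (norm (cinner x y)) = c * cinner x y"
    using False by (simp add: c_def complex_norm_square[symmetric] power2_eq_square
        mult.commute[of "cnj _"])
  then have "norm (cinner x y) = Re (cinner (c *\<^sub>C x) y)"
    by (metis Re_complex_of_real cinner_scaleC_left)
  also have "\<dots> \<le> norm (c *\<^sub>C x) * norm y"
    by (metis inner_eq_Re_cinner norm_cauchy_schwarz)
  finally show ?thesis by (simp add: norm_scaleC c)
qed simp

lemma bounded_bilinear_cinner:
  "bounded_bilinear (cinner :: 'a::complex_hilbert \<Rightarrow> 'a \<Rightarrow> complex)"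
proof
  show "\<exists>K. \<forall>a b. norm (cinner (a::'a) b) \<le> norm a * norm b * K"
    by (intro exI[of _ 1]) (simp add: norm_cinner_le)
qed (simp_all add: cinner_add_left cinner_add_right cinner_scaleR_left scaleR_eq_scaleC
    cinner_scaleC_left cinner_scaleC_right scaleC_complex_def)

lemmas cinner_diff_left = bounded_bilinear.diff_left[OF bounded_bilinear_cinner]
  and cinner_sum_left = bounded_bilinear.sum_left[OF bounded_bilinear_cinner]
  and cinner_sum_right = bounded_bilinear.sum_right[OF bounded_bilinear_cinner]
  and cinner_zero_left [simp] = bounded_bilinear.zero_left[OF bounded_bilinear_cinner]
  and cinner_zero_right [simp] = bounded_bilinear.zero_right[OF bounded_bilinear_cinner]

lemma scaleC_blinfun_apply [simp]: "blinfun_apply (c *\<^sub>C A) x = c *\<^sub>C blinfun_apply A x"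
  by (simp add: scaleC_blinfun.rep_eq)

lemma norm_scaleC_blinfun_le:
  fixes A :: "'a::real_normed_vector \<Rightarrow>\<^sub>L 'b::complex_hilbert"
  shows "norm (c *\<^sub>C A) \<le> cmod c * norm A"
proof (rule norm_blinfun_bound)
  fix x
  have "cmod c * norm (A x) \<le> cmod c * (norm A * norm x)"
    by (intro mult_left_mono norm_blinfun) simp
  then show "norm ((c *\<^sub>C A) x) \<le> cmod c * norm A * norm x"
    by (simp add: norm_scaleC mult.assoc)
qed simp

section \<open>Square-summable sequences\<close>

text \<open>
  The Hilbert sum of countably many copies of \<open>'a\<close>. Having it as a type makes every Hilbert space
  used below, and the bounded operators on it, available through the type classes.
\<close>

typedef (overloaded) 'a ell2 =
  "{f :: nat \<Rightarrow> 'a::complex_hilbert. summable (\<lambda>n. (norm (f n))\<^sup>2)}"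
  morphisms coord Abs_ell2
  by (rule exI[of _ "\<lambda>_. 0"]) simp

lemma summable_coord: "summable (\<lambda>n. (norm (coord f n))\<^sup>2)"
  using coord[of f] by simp

lemma ell2_eqI: "(\<And>n. coord f n = coord g n) \<Longrightarrow> f = g"
  by (metis coord_inject ext)

lemma summable_norm_mult:
  fixes f g :: "nat \<Rightarrow> 'a::real_normed_vector"
  assumes "summable (\<lambda>n. (norm (f n))\<^sup>2)" "summable (\<lambda>n. (norm (g n))\<^sup>2)"
  shows "summable (\<lambda>n. norm (f n) * norm (g n))"
proof (rule summable_comparison_test'[OF summable_add[OF assms], of 0])
  fix n
  have "2 * (norm (f n) * norm (g n)) \<le> (norm (f n))\<^sup>2 + (norm (g n))\<^sup>2"
    using sum_squares_bound[of "norm (f n)" "norm (g n)"] by simp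
  then show "norm (norm (f n) * norm (g n)) \<le> (norm (f n))\<^sup>2 + (norm (g n))\<^sup>2"
    using mult_nonneg_nonneg[of "norm (f n)" "norm (g n)"] by (simp del: mult_nonneg_nonneg)
qed

lemma summable_add_square:
  fixes f g :: "nat \<Rightarrow> 'a::real_normed_vector"
  assumes "summable (\<lambda>n. (norm (f n))\<^sup>2)" "summable (\<lambda>n. (norm (g n))\<^sup>2)"
  shows "summable (\<lambda>n. (norm (f n + g n))\<^sup>2)"
proof (rule summable_comparison_test'[of _ 0])
  show "summable (\<lambda>n. (norm (f n))\<^sup>2 + 2 * (norm (f n) * norm (g n)) + (norm (g n))\<^sup>2)"
    by (intro summable_add summable_mult summable_norm_mult assms)
  show "norm ((norm (f n + g n))\<^sup>2)
      \<le> (norm (f n))\<^sup>2 + 2 * (norm (f n) * norm (g n)) + (norm (g n))\<^sup>2" for n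
    using power_mono[OF norm_triangle_ineq[of "f n" "g n"], of 2]
    by (simp add: power2_sum algebra_simps)
qed

lemma summable_scaleC_square:
  fixes f :: "nat \<Rightarrow> 'a::complex_hilbert"
  assumes "summable (\<lambda>n. (norm (f n))\<^sup>2)"
  shows "summable (\<lambda>n. (norm (c *\<^sub>C f n))\<^sup>2)"
  using summable_mult[OF assms, of "(cmod c)\<^sup>2"] by (simp add: norm_scaleC power_mult_distrib)

lemma summable_cinner_coord: "summable (\<lambda>n. cinner (coord f n) (coord g n))"
proof (rule summable_comparison_test'[of _ 0])
  show "summable (\<lambda>n. norm (coord f n) * norm (coord g n))"
    by (intro summable_norm_mult summable_coord)
qed (rule norm_cinner_le)

lemma summable_inner_coord: "summable (\<lambda>n. inner (coord f n) (coord g n))"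
  using summable_Re[OF summable_cinner_coord] by (simp add: inner_eq_Re_cinner)

instantiation ell2 :: (complex_hilbert) real_inner
begin

definition zero_ell2 :: "'a ell2" where "zero_ell2 = Abs_ell2 (\<lambda>_. 0)"
definition plus_ell2 :: "'a ell2 \<Rightarrow> 'a ell2 \<Rightarrow> 'a ell2"
  where "plus_ell2 f g = Abs_ell2 (\<lambda>n. coord f n + coord g n)"
definition scaleR_ell2 :: "real \<Rightarrow> 'a ell2 \<Rightarrow> 'a ell2"
  where "scaleR_ell2 r f = Abs_ell2 (\<lambda>n. r *\<^sub>R coord f n)"
definition uminus_ell2 :: "'a ell2 \<Rightarrow> 'a ell2"
  where "uminus_ell2 f = Abs_ell2 (\<lambda>n. - coord f n)"
definition minus_ell2 :: "'a ell2 \<Rightarrow> 'a ell2 \<Rightarrow> 'a ell2" where "minus_ell2 f g = f + (- g)"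
definition inner_ell2 :: "'a ell2 \<Rightarrow> 'a ell2 \<Rightarrow> real"
  where "inner_ell2 f g = (\<Sum>n. inner (coord f n) (coord g n))"
definition norm_ell2 :: "'a ell2 \<Rightarrow> real" where "norm_ell2 f = sqrt (inner f f)"
definition dist_ell2 :: "'a ell2 \<Rightarrow> 'a ell2 \<Rightarrow> real" where "dist_ell2 f g = norm (f - g)"
definition sgn_ell2 :: "'a ell2 \<Rightarrow> 'a ell2" where "sgn_ell2 f = scaleR (inverse (norm f)) f"
definition uniformity_ell2 :: "('a ell2 \<times> 'a ell2) filter"
  where "uniformity_ell2 = (INF e\<in>{0<..}. principal {(f, g). dist f g < e})"
definition open_ell2 :: "'a ell2 set \<Rightarrow> bool"
  where "open_ell2 U \<longleftrightarrow> (\<forall>x\<in>U. eventually (\<lambda>(x', y). x' = x \<longrightarrow> y \<in> U) uniformity)"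

lemma coord_zero [simp]: "coord (0 :: 'a ell2) n = 0"
  by (simp add: zero_ell2_def Abs_ell2_inverse)

lemma coord_add [simp]: "coord (f + g :: 'a ell2) n = coord f n + coord g n"
  by (simp add: plus_ell2_def Abs_ell2_inverse summable_add_square summable_coord)

lemma coord_scaleR [simp]: "coord (scaleR r f :: 'a ell2) n = r *\<^sub>R coord f n"
  using summable_scaleC_square[OF summable_coord, of "of_real r" f]
  by (simp add: scaleR_ell2_def Abs_ell2_inverse scaleR_eq_scaleC)

lemma coord_uminus [simp]: "coord (- f :: 'a ell2) n = - coord f n"
  by (simp add: uminus_ell2_def Abs_ell2_inverse summable_coord)

lemma coord_diff [simp]: "coord (f - g :: 'a ell2) n = coord f n - coord g n"
  by (simp add: minus_ell2_def)

lemma inner_ell2_self: "inner f f = (\<Sum>n. (norm (coord f n))\<^sup>2)" for f :: "'a ell2"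
  by (simp add: inner_ell2_def power2_norm_eq_inner)

instance
proof
  fix f g h :: "'a ell2" and r s :: real and U :: "'a ell2 set"
  show "f + g + h = f + (g + h)" "f + g = g + f" "0 + f = f" "- f + f = 0" "f - g = f + - g"
    by (auto intro!: ell2_eqI simp: algebra_simps)
  show "scaleR r (f + g) = scaleR r f + scaleR r g"
    "scaleR (r + s) f = scaleR r f + scaleR s f"
    "scaleR r (scaleR s f) = scaleR (r * s) f" "scaleR 1 f = f"
    by (auto intro!: ell2_eqI simp: algebra_simps)
  show "sgn f = scaleR (inverse (norm f)) f" by (rule sgn_ell2_def)
  show "dist f g = norm (f - g)" by (rule dist_ell2_def)
  show "(uniformity :: ('a ell2 \<times> 'a ell2) filter)
      = (INF e\<in>{0<..}. principal {(f, g). dist f g < e})" by (rule uniformity_ell2_def)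
  show "open U = (\<forall>x\<in>U. \<forall>\<^sub>F (x', y) in uniformity. x' = x \<longrightarrow> y \<in> U)" by (rule open_ell2_def)
  show "inner f g = inner g f" by (simp add: inner_ell2_def inner_commute)
  show "inner (f + g) h = inner f h + inner g h"
    by (simp add: inner_ell2_def inner_add_left suminf_add summable_inner_coord)
  show "inner (scaleR r f) g = r * inner f g"
    by (simp add: inner_ell2_def suminf_mult summable_inner_coord)
  show "0 \<le> inner f f" by (simp add: inner_ell2_self suminf_nonneg summable_coord)
  show "inner f f = 0 \<longleftrightarrow> f = 0"
    by (auto simp: inner_ell2_self suminf_eq_zero_iff summable_coord intro: ell2_eqI)
  show "norm f = sqrt (inner f f)" by (rule norm_ell2_def)
qed

end

lemma norm_ell2_square: "(norm f)\<^sup>2 = (\<Sum>n. (norm (coord f n))\<^sup>2)"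
  by (metis inner_ell2_self power2_norm_eq_inner)

lemma sum_coord_le_norm: "finite I \<Longrightarrow> (\<Sum>n\<in>I. (norm (coord f n))\<^sup>2) \<le> (norm f)\<^sup>2"
  unfolding norm_ell2_square by (rule sum_le_suminf[OF summable_coord]) simp_all

lemma norm_coord_le: "norm (coord f n) \<le> norm f"
proof -
  have "(norm (coord f n))\<^sup>2 \<le> (norm f)\<^sup>2"
    using sum_coord_le_norm[of "{n}" f] by simp
  then show ?thesis by simp
qed

lemma bounded_linear_coord: "bounded_linear (\<lambda>f. coord f n)"
  by (rule bounded_linear_intro[of _ 1]) (simp_all add: norm_coord_le)

text \<open>
  Uniform bounds on the partial sums are what survives an entrywise limit, both for membership in
  $\ell^2$ and for the norm; this drives the completeness proof.
\<close>

lemma ell2_partial_sums_bound: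
  assumes "\<And>N. (\<Sum>n<N. (norm (h n :: 'a::complex_hilbert))\<^sup>2) \<le> e\<^sup>2" and "0 \<le> e"
  shows "\<exists>f. coord f = h \<and> norm f \<le> e"
proof -
  have s: "summable (\<lambda>n. (norm (h n))\<^sup>2)"
    by (rule bounded_imp_summable[of _ "e\<^sup>2"]) (use assms(1)[of "Suc _"] in \<open>simp_all add: lessThan_Suc_atMost\<close>)
  define f where "f = Abs_ell2 h"
  have f: "coord f = h" using s by (simp add: f_def Abs_ell2_inverse)
  have "(norm f)\<^sup>2 \<le> e\<^sup>2"
    unfolding norm_ell2_square f by (rule suminf_le_const[OF s assms(1)])
  then show ?thesis using f assms(2) by (auto intro: power2_le_imp_le)
qed

instance ell2 :: (complex_hilbert) banach
proof
  fix X :: "nat \<Rightarrow> 'a ell2"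
  assume X: "Cauchy X"
  have "Cauchy (\<lambda>k. coord (X k) n)" for n
    by (rule bounded_linear.Cauchy[OF bounded_linear_coord X])
  then have "\<forall>n. \<exists>l. (\<lambda>k. coord (X k) n) \<longlonglongrightarrow> l"
    using Cauchy_convergent convergent_def by blast
  then obtain g where g: "\<And>n. (\<lambda>k. coord (X k) n) \<longlonglongrightarrow> g n" by metis
  have *: "\<exists>M. \<forall>m\<ge>M. \<exists>f. coord f = (\<lambda>n. coord (X m) n - g n) \<and> norm f \<le> e" if "0 < e" for e
  proof -
    obtain M where M: "\<And>m k. m \<ge> M \<Longrightarrow> k \<ge> M \<Longrightarrow> norm (X m - X k) < e"
      using X \<open>0 < e\<close> unfolding Cauchy_iff by metis
    have "(\<Sum>n<N. (norm (coord (X m) n - g n))\<^sup>2) \<le> e\<^sup>2" if m: "m \<ge> M" for m N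
    proof (rule tendsto_upperbound)
      show "(\<lambda>k. \<Sum>n<N. (norm (coord (X m) n - coord (X k) n))\<^sup>2)
          \<longlonglongrightarrow> (\<Sum>n<N. (norm (coord (X m) n - g n))\<^sup>2)"
        by (intro tendsto_intros g)
      show "\<forall>\<^sub>F k in sequentially. (\<Sum>n<N. (norm (coord (X m) n - coord (X k) n))\<^sup>2) \<le> e\<^sup>2"
      proof (rule eventually_sequentiallyI[of M])
        fix k assume "M \<le> k"
        have "(\<Sum>n<N. (norm (coord (X m) n - coord (X k) n))\<^sup>2) \<le> (norm (X m - X k))\<^sup>2"
          using sum_coord_le_norm[of "{..<N}" "X m - X k"] by simp
        also have "\<dots> \<le> e\<^sup>2"
          using M[OF m \<open>M \<le> k\<close>] by (intro power_mono) simp_all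
        finally show "(\<Sum>n<N. (norm (coord (X m) n - coord (X k) n))\<^sup>2) \<le> e\<^sup>2" .
      qed
    qed simp
    then show ?thesis using ell2_partial_sums_bound[of "\<lambda>n. coord (X _) n - g n" e] \<open>0 < e\<close>
      by (intro exI[of _ M]) (simp add: less_imp_le)
  qed
  obtain m f where f: "coord f = (\<lambda>n. coord (X m) n - g n)" using *[of 1] by auto
  define l where "l = X m - f"
  have l: "coord l n = g n" for n by (simp add: l_def f)
  have "X \<longlonglongrightarrow> l"
  proof (rule LIMSEQ_I)
    fix e :: real assume "0 < e"
    then obtain M where M: "\<And>m. m \<ge> M \<Longrightarrow> \<exists>f. coord f = (\<lambda>n. coord (X m) n - g n) \<and> norm f \<le> e / 2"
      using *[of "e / 2"] by auto
    have "norm (X m - l) < e" if m: "m \<ge> M" for m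
    proof -
      obtain f where f: "coord f = (\<lambda>n. coord (X m) n - g n)" "norm f \<le> e / 2"
        using M[OF m] by blast
      have "X m - l = f" by (rule ell2_eqI) (simp add: f l)
      then show ?thesis using f \<open>0 < e\<close> by simp
    qed
    then show "\<exists>M. \<forall>m\<ge>M. norm (X m - l) < e" by blast
  qed
  then show "convergent X" by (rule convergentI)
qed

instantiation ell2 :: (complex_hilbert) complex_hilbert
begin

definition scaleC_ell2 :: "complex \<Rightarrow> 'a ell2 \<Rightarrow> 'a ell2"
  where "scaleC_ell2 c f = Abs_ell2 (\<lambda>n. c *\<^sub>C coord f n)"
definition cinner_ell2 :: "'a ell2 \<Rightarrow> 'a ell2 \<Rightarrow> complex"
  where "cinner_ell2 f g = (\<Sum>n. cinner (coord f n) (coord g n))"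

lemma coord_scaleC [simp]: "coord (c *\<^sub>C f :: 'a ell2) n = c *\<^sub>C coord f n"
  by (simp add: scaleC_ell2_def Abs_ell2_inverse summable_scaleC_square summable_coord)

instance
proof
  fix f g h :: "'a ell2" and r :: real and b c :: complex
  show "c *\<^sub>C (f + g) = c *\<^sub>C f + c *\<^sub>C g" "(b + c) *\<^sub>C f = b *\<^sub>C f + c *\<^sub>C f"
    "b *\<^sub>C c *\<^sub>C f = (b * c) *\<^sub>C f" "r *\<^sub>R f = complex_of_real r *\<^sub>C f"
    by (auto intro!: ell2_eqI simp: scaleC_add_right scaleC_add_left scaleC_scaleC scaleR_eq_scaleC)
  show "cinner (f + g) h = cinner f h + cinner g h"
    by (simp add: cinner_ell2_def cinner_add_left suminf_add summable_cinner_coord)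
  show "cinner (c *\<^sub>C f) g = c * cinner f g"
    by (simp add: cinner_ell2_def cinner_scaleC_left suminf_mult summable_cinner_coord)
  show "inner f g = Re (cinner f g)"
    by (simp add: inner_ell2_def cinner_ell2_def Re_suminf summable_cinner_coord inner_eq_Re_cinner)
  have "(\<lambda>n. cnj (cinner (coord g n) (coord f n))) sums cnj (cinner g f)"
    unfolding cinner_ell2_def sums_cnj by (intro summable_sums summable_cinner_coord)
  then show "cinner f g = cnj (cinner g f)"
    unfolding cinner_ell2_def by (simp add: cinner_commute[symmetric] sums_unique[symmetric])
qed

end

definition ell2_single :: "nat \<Rightarrow> 'a::complex_hilbert \<Rightarrow> 'a ell2"
  where "ell2_single k x = Abs_ell2 (\<lambda>n. if n = k then x else 0)"

lemma single_sums: "(\<lambda>n. (norm (if n = k then x else 0))\<^sup>2) sums (norm (x::'a::complex_hilbert))\<^sup>2"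
  using sums_single[of k "\<lambda>_. (norm x)\<^sup>2"] by (simp add: if_distrib[of "\<lambda>y. (norm y)\<^sup>2"] cong: if_cong)

lemma coord_single [simp]: "coord (ell2_single k x) n = (if n = k then x else 0)"
  using single_sums[of k x] by (simp add: ell2_single_def Abs_ell2_inverse sums_iff)

lemma norm_single [simp]: "norm (ell2_single k x) = norm x"
proof -
  have "(norm (ell2_single k x))\<^sup>2 = (norm x)\<^sup>2"
    unfolding norm_ell2_square coord_single by (rule sums_unique[OF single_sums, symmetric])
  then show ?thesis by simp
qed

lemma bounded_linear_single: "bounded_linear (ell2_single k)"
  by (rule bounded_linear_intro[of _ 1]) (auto intro!: ell2_eqI)

lemma single_scaleC: "ell2_single k (c *\<^sub>C x) = c *\<^sub>C ell2_single k x"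
  by (rule ell2_eqI) simp

lemma cinner_single: "cinner (ell2_single k x) f = cinner x (coord f k)"
proof -
  have "cinner (ell2_single k x) f = (\<Sum>n. if n = k then cinner x (coord f n) else 0)"
    unfolding cinner_ell2_def by (rule suminf_cong) simp
  also have "\<dots> = cinner x (coord f k)"
    by (rule sums_unique[symmetric]) (rule sums_single)
  finally show ?thesis .
qed

lemma inner_single: "inner (ell2_single k x) f = inner x (coord f k)"
  by (simp add: inner_eq_Re_cinner cinner_single)

section \<open>Orthogonal projections and adjoints\<close>

text \<open>
  A sequence in \<open>M\<close> minimising the distance to \<open>x\<close> is Cauchy by the parallelogram law, and at the
  minimum every variation along \<open>M\<close> vanishes to first order.
\<close>

lemma orthogonal_projection_exists:
  fixes x :: "'a::{real_inner, banach}"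
  assumes M: "subspace M" "closed M"
  shows "\<exists>y\<in>M. \<forall>m\<in>M. inner (x - y) m = 0"
proof -
  define q where "q = (INF m\<in>M. (norm (x - m))\<^sup>2)"
  have bdd: "bdd_below ((\<lambda>m. (norm (x - m))\<^sup>2) ` M)"
    by (rule bdd_belowI2[of _ 0]) simp
  have ne: "M \<noteq> {}" using subspace_0[OF M(1)] by blast
  have q_le: "q \<le> (norm (x - m))\<^sup>2" if "m \<in> M" for m
    unfolding q_def by (rule cINF_lower[OF bdd that])
  have "\<exists>m\<in>M. (norm (x - m))\<^sup>2 < q + inverse (of_nat (Suc n))" for n
  proof -
    have "q < q + inverse (of_nat (Suc n))" by simp
    then show ?thesis unfolding q_def cINF_less_iff[OF ne bdd] .
  qed
  then obtain y where y: "\<And>n. y n \<in> M"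
    "\<And>n. (norm (x - y n))\<^sup>2 < q + inverse (of_nat (Suc n))" by metis
  have dist: "(norm (y m - y n))\<^sup>2 \<le> 2 * inverse (of_nat (Suc m)) + 2 * inverse (of_nat (Suc n))"
    for m n
  proof -
    have "(norm (y m - y n))\<^sup>2 = 2 * (norm (x - y m))\<^sup>2 + 2 * (norm (x - y n))\<^sup>2
        - 4 * (norm (x - (1/2) *\<^sub>R (y m + y n)))\<^sup>2"
      by (simp add: power2_norm_eq_inner inner_diff_left inner_diff_right inner_add_left
          inner_add_right inner_commute algebra_simps)
    moreover have "q \<le> (norm (x - (1/2) *\<^sub>R (y m + y n)))\<^sup>2"
      by (intro q_le subspace_scale subspace_add M y)
    ultimately show ?thesis using y(2)[of m] y(2)[of n] by linarith
  qed
  have "Cauchy y"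
    unfolding Cauchy_iff
  proof (intro allI impI)
    fix e :: real assume "0 < e"
    then obtain N where N: "inverse (of_nat (Suc N)) < e\<^sup>2 / 4"
      using reals_Archimedean[of "e\<^sup>2 / 4"] by auto
    have "norm (y m - y n) < e" if "m \<ge> N" "n \<ge> N" for m n
    proof (rule power2_less_imp_less)
      have "inverse (of_nat (Suc m)) \<le> inverse (real (Suc N))"
        "inverse (of_nat (Suc n)) \<le> inverse (real (Suc N))"
        using that by (simp_all add: field_simps)
      then show "(norm (y m - y n))\<^sup>2 < e\<^sup>2" using dist[of m n] N by linarith
    qed (use \<open>0 < e\<close> in simp)
    then show "\<exists>N. \<forall>m\<ge>N. \<forall>n\<ge>N. norm (y m - y n) < e" by blast
  qed
  then obtain l where l: "y \<longlonglongrightarrow> l" using Cauchy_convergent convergent_def by blast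
  have lM: "l \<in> M" using closed_sequentially[OF M(2) _ l] y by blast
  have "(norm (x - l))\<^sup>2 \<le> q + 0"
  proof (rule LIMSEQ_le)
    show "(\<lambda>n. (norm (x - y n))\<^sup>2) \<longlonglongrightarrow> (norm (x - l))\<^sup>2" by (intro tendsto_intros l)
    show "(\<lambda>n. q + inverse (of_nat (Suc n))) \<longlonglongrightarrow> q + 0"
      by (intro tendsto_intros LIMSEQ_inverse_real_of_nat)
  qed (use y(2) less_imp_le in blast)
  then have min: "(norm (x - l))\<^sup>2 \<le> (norm (x - m))\<^sup>2" if "m \<in> M" for m
    using q_le[OF that] by linarith
  have "inner (x - l) m = 0" if "m \<in> M" for m
  proof (rule ccontr)
    assume nz: "inner (x - l) m \<noteq> 0"
    then have m: "inner m m > 0" by auto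
    \<comment> \<open>The step along \<open>m\<close> that minimises the distance to \<open>x\<close>.\<close>
    define t where "t = inner (x - l) m / inner m m"
    have "(norm (x - l))\<^sup>2 \<le> (norm (x - (l + t *\<^sub>R m)))\<^sup>2"
      by (intro min subspace_add subspace_scale M lM that)
    also have "x - (l + t *\<^sub>R m) = (x - l) - t *\<^sub>R m" by simp
    also have "(norm \<dots>)\<^sup>2 = (norm (x - l))\<^sup>2 - 2 * t * inner (x - l) m + t * t * inner m m"
      unfolding power2_norm_eq_inner
      by (simp add: inner_diff_left[of _ "t *\<^sub>R m"] inner_diff_right[of _ _ "t *\<^sub>R m"]
          inner_commute[of m "x - l"] right_diff_distrib)
    also have "t * t * inner m m = t * inner (x - l) m" using m by (simp add: t_def)
    finally have "t * inner (x - l) m \<le> 0" by simp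
    moreover have "t * inner (x - l) m > 0"
      using nz m by (simp add: t_def flip: power2_eq_square)
    ultimately show False by simp
  qed
  then show ?thesis using lM by blast
qed

text \<open>
  The kernel of a nonzero functional is closed and of codimension one, so a multiple of a vector
  orthogonal to it represents the functional.
\<close>

lemma riesz_representation:
  fixes f :: "'a::{real_inner, banach} \<Rightarrow> real"
  assumes f: "bounded_linear f"
  shows "\<exists>y. \<forall>x. f x = inner x y"
proof (cases "\<forall>x. f x = 0")
  case False
  then obtain x0 where x0: "f x0 \<noteq> 0" by blast
  have lin: "linear f" using f by (rule bounded_linear.linear)
  have "closed (f -` {0})"
    by (intro closed_vimage closed_singleton bounded_linear.continuous_on[OF f] continuous_on_id)
  then obtain p where p: "f p = 0" "\<And>m. f m = 0 \<Longrightarrow> inner (x0 - p) m = 0"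
    using orthogonal_projection_exists[of "f -` {0}" x0] linear_subspace_vimage[OF lin, of "{0}"]
    by auto
  define z where "z = x0 - p"
  have fz: "f z \<noteq> 0" using x0 p lin by (simp add: z_def linear_diff)
  then have "z \<noteq> 0" using linear_0[OF lin] by auto
  have "f x = inner x ((f z / inner z z) *\<^sub>R z)" for x
  proof -
    have "inner z (x - (f x / f z) *\<^sub>R z) = 0"
      unfolding z_def
      by (rule p(2)) (use fz lin in \<open>simp add: linear_diff linear_cmul flip: z_def\<close>)
    then show ?thesis
      using fz \<open>z \<noteq> 0\<close> by (simp add: inner_diff_right inner_commute[of z x] field_simps)
  qed
  then show ?thesis by blast
qed (auto intro: exI[of _ 0])

lemma real_adjoint_exists:
  fixes A :: "'a::{real_inner, banach} \<Rightarrow>\<^sub>L 'b::real_inner"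
  shows "\<exists>B :: 'b \<Rightarrow>\<^sub>L 'a. \<forall>x y. inner (A x) y = inner x (B y)"
proof -
  have "\<exists>z. \<forall>x. inner (A x) y = inner x z" for y
    by (rule riesz_representation)
       (rule bounded_linear_inner_left_comp[OF blinfun.bounded_linear_right])
  then obtain B where B: "\<And>x y. inner (A x) y = inner x (B y)" by metis
  have eqI: "u = v" if "\<And>x. inner x u = inner x v" for u v :: 'a
    using that vector_eq_ldot by blast
  have "bounded_linear B"
  proof (rule bounded_linear_intro)
    show "B (x + y) = B x + B y" for x y
      by (rule eqI) (simp add: inner_add_right flip: B)
    show "B (r *\<^sub>R x) = r *\<^sub>R B x" for r x
      by (rule eqI) (simp flip: B)
    show "norm (B y) \<le> norm y * norm A" for y
    proof (cases "norm (B y) = 0")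
      case False
      have "norm (B y) * norm (B y) = inner (A (B y)) y"
        by (simp add: B flip: power2_norm_eq_inner power2_eq_square)
      also have "\<dots> \<le> norm (A (B y)) * norm y" by (rule norm_cauchy_schwarz)
      also have "\<dots> \<le> norm A * norm (B y) * norm y"
        by (intro mult_right_mono norm_blinfun) simp
      finally show ?thesis using False by (simp add: mult.commute mult.left_commute)
    qed simp
  qed
  then show ?thesis using B by (intro exI[of _ "Blinfun B"]) (simp add: bounded_linear_Blinfun_apply)
qed

text \<open>
  The definite description in the definition of \<open>cadjoint\<close> denotes only if an adjoint exists. The
  adjoint with respect to the real inner product is one for the complex inner product
  because \<open>A\<close> commutes with multiplication by $-i$.
\<close>

lemma cinner_cadjoint:
  fixes A :: "'a::complex_hilbert \<Rightarrow>\<^sub>L 'a"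
  assumes "A \<in> bounded_clinear_ops"
  shows "cinner (A x) y = cinner x (cadjoint A y)"
proof -
  obtain B :: "'a \<Rightarrow>\<^sub>L 'a" where "\<And>x y. inner (A x) y = inner x (B y)"
    using real_adjoint_exists by blast
  then have re: "inner (A x) y = inner x (B y)" for x y .
  have B: "cinner (A x) y = cinner x (B y)" for x y
  proof -
    have "- \<i> *\<^sub>C A x = A (- \<i> *\<^sub>C x)" using assms by (simp add: bounded_clinear_ops_def)
    then show ?thesis by (simp only: cinner_conv_inner re)
  qed
  then show ?thesis using cadjoint_unique[of A B] by simp
qed

section \<open>Extension of contractions\<close>

lemma subspace_closure:
  assumes "subspace (S :: 'a::real_normed_vector set)"
  shows "subspace (closure S)"
  unfolding subspace_def
proof (intro conjI ballI allI)
  show "0 \<in> closure S" using subspace_0[OF assms] by (rule subsetD[OF closure_subset])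
next
  fix x y assume "x \<in> closure S" "y \<in> closure S"
  then obtain f g where fg: "\<And>n. f n \<in> S" "f \<longlonglongrightarrow> x" "\<And>n. g n \<in> S" "g \<longlonglongrightarrow> y"
    unfolding closure_sequential by metis
  show "x + y \<in> closure S"
    unfolding closure_sequential
    by (intro exI[of _ "\<lambda>n. f n + g n"] conjI allI tendsto_add subspace_add[OF assms] fg)
next
  fix r x assume "x \<in> closure S"
  then obtain f where f: "\<And>n. f n \<in> S" "f \<longlonglongrightarrow> x"
    unfolding closure_sequential by metis
  show "r *\<^sub>R x \<in> closure S"
    unfolding closure_sequential
    by (intro exI[of _ "\<lambda>n. r *\<^sub>R f n"] conjI allI tendsto_intros subspace_scale[OF assms] f)
qed

text \<open>
  Douglas' factorization $V = T U$ of an operator dominated by $U$. On the range of $U$ the rule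
  $U f \mapsto V f$ is well defined and contractive; it extends to the closure of the range by
  continuity, and by zero to the orthogonal complement. The extension to the closure is described by
  the closure \<open>\<Gamma>\<close> of the graph, which remains the graph of a contraction.
\<close>

lemma contraction_factorization:
  fixes U V :: "'h::complex_hilbert \<Rightarrow> 'g::complex_hilbert"
  assumes U: "linear U" "\<And>c f. U (c *\<^sub>C f) = c *\<^sub>C U f"
    and V: "linear V" "\<And>c f. V (c *\<^sub>C f) = c *\<^sub>C V f"
    and le: "\<And>f. norm (V f) \<le> norm (U f)"
  shows "\<exists>T :: 'g \<Rightarrow>\<^sub>L 'g. T \<in> bounded_clinear_ops \<and> (\<forall>g. norm (T g) \<le> norm g) \<and>
    (\<forall>f. T (U f) = V f)"
proof -
  define \<Gamma> where "\<Gamma> = closure (range (\<lambda>f. (U f, V f)))"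
  \<comment> \<open>\<open>u\<close> is the projection of \<open>g\<close> to the closure of the range of \<open>U\<close>, and \<open>v\<close> is its image.\<close>
  define R where "R g v \<longleftrightarrow> (\<exists>u. (u, v) \<in> \<Gamma> \<and> (\<forall>f. inner (g - u) (U f) = 0))" for g v
  have lin: "linear (\<lambda>f. (U f, V f))"
    using U(1) V(1) by (auto simp: linear_iff)
  have sub: "subspace \<Gamma>"
    unfolding \<Gamma>_def by (intro subspace_closure linear_subspace_image lin) (rule subspace_UNIV)
  have subU: "subspace (closure (range U))"
    by (intro subspace_closure linear_subspace_image U(1)) (rule subspace_UNIV)
  have \<Gamma>I: "(U f, V f) \<in> \<Gamma>" for f
    unfolding \<Gamma>_def by (rule subsetD[OF closure_subset]) blast
  have \<Gamma>_le: "norm v \<le> norm u" if "(u, v) \<in> \<Gamma>" for u v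
  proof -
    have "\<Gamma> \<subseteq> {p. norm (snd p) \<le> norm (fst p)}"
      unfolding \<Gamma>_def
      by (intro closure_minimal closed_Collect_le continuous_intros) (auto simp: le)
    then show ?thesis using that by auto
  qed
  have \<Gamma>_fst: "u \<in> closure (range U)" if "(u, v) \<in> \<Gamma>" for u v
  proof -
    have "fst ` \<Gamma> \<subseteq> closure (range U)"
      unfolding \<Gamma>_def
      by (intro image_closure_subset continuous_intros closed_closure)
         (auto intro!: subsetD[OF closure_subset])
    then show ?thesis using that by force
  qed
  have \<Gamma>_scaleC: "(c *\<^sub>C u, c *\<^sub>C v) \<in> \<Gamma>" if "(u, v) \<in> \<Gamma>" for c u v
  proof -
    have "(\<lambda>p. (c *\<^sub>C fst p, c *\<^sub>C snd p)) ` \<Gamma> \<subseteq> \<Gamma>"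
      unfolding \<Gamma>_def
    proof (intro image_closure_subset closed_closure)
      show "continuous_on (closure (range (\<lambda>f. (U f, V f)))) (\<lambda>p. (c *\<^sub>C fst p, c *\<^sub>C snd p))"
        by (intro continuous_intros bounded_linear.continuous_on[OF bounded_linear_scaleC])
      show "(\<lambda>p. (c *\<^sub>C fst p, c *\<^sub>C snd p)) ` range (\<lambda>f. (U f, V f))
          \<subseteq> closure (range (\<lambda>f. (U f, V f)))"
        using \<Gamma>I unfolding \<Gamma>_def by (auto simp flip: U(2) V(2))
    qed
    then show ?thesis using that by force
  qed
  have orth: "u = 0" if "u \<in> closure (range U)" "\<And>f. inner u (U f) = 0" for u
  proof -
    have "closure (range U) \<subseteq> {x. inner u x = 0}"
      by (intro closure_minimal closed_Collect_eq continuous_intros) (auto simp: that(2))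
    then show ?thesis using that(1) by auto
  qed
  have ex: "\<exists>v. R g v" for g
  proof -
    obtain u where u: "u \<in> closure (range U)" "\<And>m. m \<in> closure (range U) \<Longrightarrow> inner (g - u) m = 0"
      using orthogonal_projection_exists[OF subU closed_closure, of g] by blast
    obtain s where s: "\<And>n. s n \<in> range U" "s \<longlonglongrightarrow> u"
      using u(1) unfolding closure_sequential by metis
    have "\<forall>n. \<exists>f. s n = U f" using s(1) by (auto simp: image_iff)
    then obtain f where f: "\<And>n. s n = U (f n)" by metis
    have Uf: "(\<lambda>n. U (f n)) \<longlonglongrightarrow> u" using s(2) by (simp flip: f)
    have "Cauchy (\<lambda>n. V (f n))"
      unfolding Cauchy_iff
    proof (intro allI impI)
      fix e :: real assume "0 < e"
      then obtain N where N: "\<And>m n. m \<ge> N \<Longrightarrow> n \<ge> N \<Longrightarrow> norm (s m - s n) < e"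
        using LIMSEQ_imp_Cauchy[OF s(2)] unfolding Cauchy_iff by metis
      then have "norm (V (f m) - V (f n)) < e" if "m \<ge> N" "n \<ge> N" for m n
        using le[of "f m - f n"] N[OF that] U(1) V(1) by (simp add: linear_diff f)
      then show "\<exists>N. \<forall>m\<ge>N. \<forall>n\<ge>N. norm (V (f m) - V (f n)) < e" by blast
    qed
    then obtain v where v: "(\<lambda>n. V (f n)) \<longlonglongrightarrow> v"
      using Cauchy_convergent convergent_def by blast
    have "(u, v) \<in> \<Gamma>"
      unfolding \<Gamma>_def closure_sequential
      by (intro exI[of _ "\<lambda>n. (U (f n), V (f n))"] conjI allI tendsto_Pair Uf v) simp
    moreover have "U x \<in> closure (range U)" for x by (auto intro!: subsetD[OF closure_subset])
    ultimately show ?thesis unfolding R_def using u(2) by blast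
  qed
  have unique: "v = v'" if "R g v" "R g v'" for g v v'
  proof -
    obtain u u' where u: "(u, v) \<in> \<Gamma>" "\<And>f. inner (g - u) (U f) = 0"
      and u': "(u', v') \<in> \<Gamma>" "\<And>f. inner (g - u') (U f) = 0"
      using \<open>R g v\<close> \<open>R g v'\<close> unfolding R_def by blast
    have \<Gamma>: "(u - u', v - v') \<in> \<Gamma>" using subspace_diff[OF sub u(1) u'(1)] by simp
    have "u - u' = 0"
      using u(2) u'(2) by (intro orth \<Gamma>_fst[OF \<Gamma>]) (simp add: inner_diff_left)
    then show ?thesis using \<Gamma>_le[OF \<Gamma>] by simp
  qed
  define T where "T g = (THE v. R g v)" for g
  have T: "R g (T g)" for g
    unfolding T_def using ex unique by (blast intro: theI)
  have R_add: "R (g + g') (v + v')" if "R g v" "R g' v'" for g g' v v'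
  proof -
    obtain u u' where u: "(u, v) \<in> \<Gamma>" "\<And>f. inner (g - u) (U f) = 0"
      and u': "(u', v') \<in> \<Gamma>" "\<And>f. inner (g' - u') (U f) = 0"
      using \<open>R g v\<close> \<open>R g' v'\<close> unfolding R_def by blast
    have "(u + u', v + v') \<in> \<Gamma>" using subspace_add[OF sub u(1) u'(1)] by simp
    moreover have "inner (g + g' - (u + u')) (U f) = 0" for f
      using u(2)[of f] u'(2)[of f] by (simp add: inner_diff_left inner_add_left)
    ultimately show ?thesis unfolding R_def by blast
  qed
  have R_scaleC: "R (c *\<^sub>C g) (c *\<^sub>C v)" if "R g v" for c g v
  proof -
    obtain u where u: "(u, v) \<in> \<Gamma>" "\<And>f. inner (g - u) (U f) = 0"
      using \<open>R g v\<close> unfolding R_def by blast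
    have "inner (c *\<^sub>C g - c *\<^sub>C u) (U f) = 0" for f
    proof -
      have "inner (c *\<^sub>C g - c *\<^sub>C u) (U f) = Re (cinner (g - u) (U (cnj c *\<^sub>C f)))"
        by (simp add: inner_eq_Re_cinner cinner_scaleC_left cinner_scaleC_right U(2)
            flip: scaleC_diff_right)
      then show ?thesis using u(2) by (simp add: inner_eq_Re_cinner)
    qed
    then show ?thesis unfolding R_def using \<Gamma>_scaleC[OF u(1)] by blast
  qed
  have R_le: "norm v \<le> norm g" if "R g v" for g v
  proof -
    obtain u where u: "(u, v) \<in> \<Gamma>" "\<And>f. inner (g - u) (U f) = 0"
      using \<open>R g v\<close> unfolding R_def by blast
    have "closure (range U) \<subseteq> {x. inner (g - u) x = 0}"
      by (intro closure_minimal closed_Collect_eq continuous_intros) (auto simp: u(2))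
    then have "inner (g - u) u = 0" using \<Gamma>_fst[OF u(1)] by auto
    then have "(norm u)\<^sup>2 = inner g u" by (simp add: inner_diff_left power2_norm_eq_inner)
    also have "\<dots> \<le> norm g * norm u" by (rule norm_cauchy_schwarz)
    finally have "norm u \<le> norm g" by (cases "u = 0") (simp_all add: power2_eq_square)
    then show ?thesis using \<Gamma>_le[OF u(1)] by simp
  qed
  have "bounded_linear T"
  proof (rule bounded_linear_intro[of _ 1])
    show "T (x + y) = T x + T y" for x y by (rule unique[OF T R_add[OF T T]])
    show "T (r *\<^sub>R x) = r *\<^sub>R T x" for r x
      unfolding scaleR_eq_scaleC by (rule unique[OF T R_scaleC[OF T]])
  qed (use R_le[OF T] in simp)
  then have *: "blinfun_apply (Blinfun T) = T" by (rule bounded_linear_Blinfun_apply)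
  have "T (c *\<^sub>C x) = c *\<^sub>C T x" for c x by (rule unique[OF T R_scaleC[OF T]])
  moreover have "R (U f) (V f)" for f unfolding R_def using \<Gamma>I by (intro exI[of _ "U f"]) simp
  then have "T (U f) = V f" for f by (rule unique[OF T])
  ultimately show ?thesis
    using R_le[OF T] by (intro exI[of _ "Blinfun T"]) (simp add: * bounded_clinear_ops_def)
qed

section \<open>Factorization of positive operators\<close>

text \<open>
  The order relations $0 \le P \le I$ between self-adjoint operators, spelled out as quadratic forms.
\<close>

definition positive_contraction :: "('h::real_inner \<Rightarrow>\<^sub>L 'h) \<Rightarrow> bool"
  where "positive_contraction P \<longleftrightarrow> (\<forall>x y. inner (P x) y = inner x (P y)) \<and>
    (\<forall>x. 0 \<le> inner (P x) x \<and> inner (P x) x \<le> inner x x)"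

text \<open>
  The lower bound is the identity $P - P^2 = P (I - P) P + (I - P) P (I - P)$, whose right-hand side
  is a sum of two positive operators.
\<close>

lemma positive_contraction_diff_square:
  assumes P: "positive_contraction P"
  shows "positive_contraction (P - (P o\<^sub>L P))"
proof -
  have sym: "inner (P x) y = inner x (P y)" and ge: "0 \<le> inner (P x) x"
    and le: "inner (P x) x \<le> inner x x" for x y
    using P by (auto simp: positive_contraction_def)
  have eq: "inner (P x - P (P x)) x = inner (P x) x - inner (P x) (P x)" for x
    using sym[of "P x" x] by (simp add: inner_diff_left)
  have "inner (P x - P (P x)) x = (inner (P x) (P x) - inner (P (P x)) (P x))
      + inner (P (x - P x)) (x - P x)" for x
    using sym[of "P x" x] sym[of "P (P x)" x]
    by (simp add: blinfun.diff_right inner_diff_left inner_diff_right)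
  then have "0 \<le> inner (P x - P (P x)) x" for x
    using ge[of "x - P x"] le[of "P x"] by simp
  moreover have "inner (P x - P (P x)) x \<le> inner x x" for x
    using le[of x] inner_ge_zero[of "P x"] unfolding eq by linarith
  moreover have "inner (P x - P (P x)) y = inner x (P y - P (P y))" for x y
    using sym[of x y] sym[of "P x" y] sym[of x "P y"]
    by (simp add: inner_diff_left inner_diff_right)
  ultimately show ?thesis
    by (simp add: positive_contraction_def blinfun.diff_left)
qed

primrec diff_square_iterate :: "('h::real_inner \<Rightarrow>\<^sub>L 'h) \<Rightarrow> nat \<Rightarrow> 'h \<Rightarrow>\<^sub>L 'h" where
  "diff_square_iterate P 0 = P"
| "diff_square_iterate P (Suc n) =
    diff_square_iterate P n - (diff_square_iterate P n o\<^sub>L diff_square_iterate P n)"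

text \<open>
  By construction $\|P_n x\|^2 = \langle P_n x, x \rangle - \langle P_{n+1} x, x \rangle$. The partial
  sums telescope and stay below $\langle P x, x \rangle$, so $P_n x \to 0$, and the remainder
  $\langle P_n x, x \rangle$ vanishes in the limit.
\<close>

lemma diff_square_iterate_sums:
  assumes P: "positive_contraction P"
  shows "(\<lambda>n. (norm (diff_square_iterate P n x))\<^sup>2) sums inner (P x) x"
proof -
  let ?P = "diff_square_iterate P"
  have pc: "positive_contraction (?P n)" for n
    by (induction n) (simp_all add: P positive_contraction_diff_square)
  have step: "inner (?P (Suc n) x) x = inner (?P n x) x - (norm (?P n x))\<^sup>2" for n
    using pc[of n] by (simp add: positive_contraction_def blinfun.diff_left inner_diff_left
        power2_norm_eq_inner)
  have tele: "(\<Sum>k<n. (norm (?P k x))\<^sup>2) = inner (P x) x - inner (?P n x) x" for n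
    by (induction n) (simp_all add: step del: diff_square_iterate.simps(2))
  have "summable (\<lambda>n. (norm (?P n x))\<^sup>2)"
  proof (rule bounded_imp_summable[of _ "inner (P x) x"])
    fix n
    have "0 \<le> inner (?P (Suc n) x) x"
      using pc[of "Suc n"] unfolding positive_contraction_def by blast
    then show "(\<Sum>k\<le>n. (norm (?P k x))\<^sup>2) \<le> inner (P x) x"
      using tele[of "Suc n"] by (simp add: lessThan_Suc_atMost)
  qed simp
  then have "(\<lambda>n. (norm (?P n x))\<^sup>2) \<longlonglongrightarrow> 0" by (rule summable_LIMSEQ_zero)
  then have "(\<lambda>n. norm (?P n x)) \<longlonglongrightarrow> 0"
    using tendsto_real_sqrt by fastforce
  then have "(\<lambda>n. ?P n x) \<longlonglongrightarrow> 0" by (rule tendsto_norm_zero_cancel)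
  then have "(\<lambda>n. inner (P x) x - inner (?P n x) x) \<longlonglongrightarrow> inner (P x) x - inner 0 x"
    by (intro tendsto_intros)
  then show ?thesis unfolding sums_def tele by simp
qed

text \<open>
  Up to scaling, \<open>R x\<close> is the sequence of the $P_n x$. It is shifted by one place: the vacant zeroth
  entry will later hold the space on which the interpolant acts, orthogonally to the range of \<open>R\<close>.
\<close>

lemma positive_operator_factorization:
  fixes P :: "'h::complex_hilbert \<Rightarrow>\<^sub>L 'h"
  assumes P: "P \<in> bounded_clinear_ops" "\<And>x y. inner (P x) y = inner x (P y)"
    "\<And>x. 0 \<le> inner (P x) x"
  shows "\<exists>R :: 'h \<Rightarrow> 'h ell2. linear R \<and> (\<forall>c x. R (c *\<^sub>C x) = c *\<^sub>C R x) \<and>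
    (\<forall>x. coord (R x) 0 = 0) \<and> (\<forall>x. (norm (R x))\<^sup>2 = inner (P x) x)"
proof -
  \<comment> \<open>Scaling by any \<open>M > 0\<close> that is at least the norm of \<open>P\<close> brings \<open>P\<close> below the identity.\<close>
  define M where "M = norm P + 1"
  have M: "M > 0" using norm_ge_zero[of P] by (simp add: M_def add_nonneg_pos)
  define Q where "Q = (1 / M) *\<^sub>R P"
  have "inner (P x) x \<le> M * inner x x" for x
  proof -
    have "inner (P x) x \<le> norm (P x) * norm x" by (rule norm_cauchy_schwarz)
    also have "\<dots> \<le> norm P * norm x * norm x" by (intro mult_right_mono norm_blinfun) simp
    also have "\<dots> \<le> M * inner x x"
      by (simp add: M_def power2_norm_eq_inner[symmetric] power2_eq_square algebra_simps)
    finally show ?thesis .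
  qed
  then have Q: "positive_contraction Q"
    using P M by (simp add: positive_contraction_def Q_def blinfun.scaleR_left field_simps)
  have hom: "diff_square_iterate Q n (c *\<^sub>C x) = c *\<^sub>C diff_square_iterate Q n x" for n c x
    using P(1) by (induction n arbitrary: x)
      (simp_all add: Q_def bounded_clinear_ops_def blinfun.scaleR_left blinfun.diff_left
        scaleC_diff_right scaleC_scaleR_commute)
  define r where "r x n = (case n of 0 \<Rightarrow> 0 | Suc m \<Rightarrow> sqrt M *\<^sub>R diff_square_iterate Q m x)" for x n
  have "(\<lambda>n. M * (norm (diff_square_iterate Q n x))\<^sup>2) sums (M * inner (Q x) x)" for x
    by (intro sums_mult diff_square_iterate_sums Q)
  then have "(\<lambda>n. (norm (r x (Suc n)))\<^sup>2) sums inner (P x) x" for x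
    using M by (simp add: r_def Q_def blinfun.scaleR_left power_mult_distrib)
  from sums_Suc[OF this] have sums: "(\<lambda>n. (norm (r x n))\<^sup>2) sums inner (P x) x" for x
    by (simp add: r_def)
  define R where "R x = Abs_ell2 (r x)" for x
  have R: "coord (R x) = r x" for x
    using sums by (simp add: R_def Abs_ell2_inverse sums_iff)
  have "linear R"
    by (rule linearI)
       (auto intro!: ell2_eqI simp: R r_def blinfun.add_right blinfun.scaleR_right
         scaleR_add_right split: nat.split)
  moreover have "R (c *\<^sub>C x) = c *\<^sub>C R x" for c x
    by (rule ell2_eqI) (simp add: R r_def hom scaleC_scaleR_commute split: nat.split)
  moreover have "(norm (R x))\<^sup>2 = inner (P x) x" for x
    unfolding norm_ell2_square R by (rule sums_unique[OF sums, symmetric])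
  moreover have "coord (R x) 0 = 0" for x by (simp add: R r_def)
  ultimately show ?thesis by (intro exI[of _ R]) blast
qed

section \<open>Transfer functions\<close>

text \<open>
  Here \<open>J\<close> embeds \<open>'e\<close> isometrically into \<open>'g\<close>, and \<open>L\<close> is its adjoint; the hypothesis \<open>pyth\<close> encodes
  that \<open>J L\<close> is the orthogonal projection onto the range of \<open>J\<close>. With $D = (I - J L) T$ the function
  is $\Phi(z) = L T (I - z D)^{-1} J$, and $u = (I - z D)^{-1} J x$ is the only solution of the state equation
  $u = J x + z D u$. The conclusion speaks of this equation, so that values of \<open>\<Phi>\<close> can be read off from any solution
  without inverting operators. Contractivity is the energy balance
  $\|\Phi(z) x\|^2 + \|D u\|^2 = \|T u\|^2 \le \|u\|^2 = \|x\|^2 + |z|^2 \|D u\|^2$.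
\<close>

lemma transfer_function_Hinf:
  fixes T :: "'g::complex_hilbert \<Rightarrow>\<^sub>L 'g" and J :: "'e::complex_hilbert \<Rightarrow>\<^sub>L 'g" and L :: "'g \<Rightarrow>\<^sub>L 'e"
  assumes T: "T \<in> bounded_clinear_ops" "\<And>g. norm (T g) \<le> norm g"
    and J: "\<And>c x. J (c *\<^sub>C x) = c *\<^sub>C J x" and L: "\<And>c g. L (c *\<^sub>C g) = c *\<^sub>C L g"
    and LJ: "\<And>x. L (J x) = x"
    and pyth: "\<And>g. (norm g)\<^sup>2 = (norm (L g))\<^sup>2 + (norm (g - J (L g)))\<^sup>2"
  shows "\<exists>\<Phi>::complex \<Rightarrow> 'e \<Rightarrow>\<^sub>L 'e. \<Phi> \<in> Hinf \<and> (\<forall>z\<in>ball 0 1. norm (\<Phi> z) \<le> 1) \<and>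
    (\<forall>z\<in>ball 0 1. \<forall>x u. u = J x + z *\<^sub>C (T u - J (L (T u))) \<longrightarrow> \<Phi> z x = L (T u))"
proof -
  define D where "D = T - (J o\<^sub>L L o\<^sub>L T)"
  have D: "D g = T g - J (L (T g))" for g by (simp add: D_def blinfun.diff_left)
  have LD: "L (D g) = 0" for g by (simp add: D blinfun.diff_right LJ)
  have TD: "(norm (T g))\<^sup>2 = (norm (L (T g)))\<^sup>2 + (norm (D g))\<^sup>2" for g
    unfolding D by (rule pyth)
  have Tc: "T (c *\<^sub>C g) = c *\<^sub>C T g" for c g using T(1) by (simp add: bounded_clinear_ops_def)
  have Dc: "D (c *\<^sub>C g) = c *\<^sub>C D g" for c g by (simp add: D Tc L J scaleC_diff_right)
  have D_le: "norm (D g) \<le> norm g" for g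
  proof -
    have "(norm (D g))\<^sup>2 \<le> (norm (T g))\<^sup>2" unfolding TD by simp
    then show ?thesis using T(2)[of g] by simp
  qed
  have normJ: "norm (J x) = norm x" for x using pyth[of "J x"] by (simp add: LJ)
  have normL: "norm (L g) \<le> norm g" for g
    by (rule power2_le_imp_le) (simp_all add: pyth[of g])
  define X where "X n = (((o\<^sub>L) D) ^^ n) J" for n
  have X0: "X 0 = J" and XS: "X (Suc n) x = D (X n x)" for n x by (simp_all add: X_def)
  have Xc: "X n (c *\<^sub>C x) = c *\<^sub>C X n x" for n c x
    by (induction n) (simp_all add: X0 XS J Dc)
  have X_le: "norm (X n x) \<le> norm x" for n x
    by (induction n) (simp_all add: X0 XS normJ order_trans[OF D_le])
  define A where "A n = L o\<^sub>L T o\<^sub>L X n" for n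
  have A_mem: "A n \<in> bounded_clinear_ops" for n
    by (simp add: bounded_clinear_ops_def A_def Xc Tc L)
  have A_le: "norm (A n) \<le> 1" for n
    by (rule norm_blinfun_bound)
       (use order_trans[OF normL order_trans[OF T(2) X_le]] in \<open>simp_all add: A_def\<close>)
  define \<Phi> :: "complex \<Rightarrow> 'e \<Rightarrow>\<^sub>L 'e" where "\<Phi> z = (\<Sum>n. z ^ n *\<^sub>C A n)" for z
  have sums: "(\<lambda>n. z ^ n *\<^sub>C A n) sums \<Phi> z" if "z \<in> ball 0 1" for z
  proof -
    have "summable (\<lambda>n. z ^ n *\<^sub>C A n)"
    proof (rule summable_comparison_test'[of "\<lambda>n. cmod z ^ n" 0])
      show "summable (\<lambda>n. cmod z ^ n)" using that by (simp add: summable_geometric)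
      fix n
      have "cmod (z ^ n) * norm (A n) \<le> cmod (z ^ n) * 1" by (intro mult_left_mono A_le) simp
      then show "norm (z ^ n *\<^sub>C A n) \<le> cmod z ^ n"
        using norm_scaleC_blinfun_le[of "z ^ n" "A n"] by (simp add: norm_power)
    qed
    then show ?thesis unfolding \<Phi>_def by (rule summable_sums)
  qed
  have state: "\<exists>u. u = J x + z *\<^sub>C D u \<and> \<Phi> z x = L (T u)" if z: "z \<in> ball 0 1" for z x
  proof -
    have "summable (\<lambda>n. z ^ n *\<^sub>C X n x)"
    proof (rule summable_comparison_test'[of "\<lambda>n. cmod z ^ n * norm x" 0])
      show "summable (\<lambda>n. cmod z ^ n * norm x)"
        using z by (intro summable_mult2) (simp add: summable_geometric)
    qed (simp add: norm_scaleC norm_power X_le mult_left_mono)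
    then obtain u where u: "(\<lambda>n. z ^ n *\<^sub>C X n x) sums u" using summable_sums by blast
    have "bounded_linear (\<lambda>g. z *\<^sub>C D g)"
      by (rule bounded_linear_compose[OF bounded_linear_scaleC blinfun.bounded_linear_right])
    from bounded_linear.sums[OF this u]
    have "(\<lambda>n. z ^ Suc n *\<^sub>C X (Suc n) x) sums (z *\<^sub>C D u)"
      by (simp add: Dc XS scaleC_scaleC)
    from sums_Suc[OF this] have "(\<lambda>n. z ^ n *\<^sub>C X n x) sums (J x + z *\<^sub>C D u)"
      by (simp add: X0 add.commute)
    then have eq: "u = J x + z *\<^sub>C D u" by (rule sums_unique2[OF u])
    have "(\<lambda>n. (z ^ n *\<^sub>C A n) x) sums \<Phi> z x"
      by (rule bounded_linear.sums[OF blinfun.bounded_linear_left sums[OF z]])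
    moreover have "(\<lambda>n. (L o\<^sub>L T) (z ^ n *\<^sub>C X n x)) sums (L o\<^sub>L T) u"
      by (rule bounded_linear.sums[OF blinfun.bounded_linear_right u])
    ultimately have "\<Phi> z x = L (T u)"
      by (simp add: A_def Tc L sums_unique2)
    with eq show ?thesis by blast
  qed
  have contr: "norm (\<Phi> z x) \<le> norm x" if z: "z \<in> ball 0 1" for z x
  proof -
    obtain u where u: "u = J x + z *\<^sub>C D u" "\<Phi> z x = L (T u)" using state[OF z] by blast
    have Lu: "L u = x" by (subst u(1)) (simp add: blinfun.add_right LJ L LD)
    have uJ: "u - J x = z *\<^sub>C D u" using u(1) by (metis add_diff_cancel_left')
    have "(norm (\<Phi> z x))\<^sup>2 + (norm (D u))\<^sup>2 = (norm (T u))\<^sup>2" by (simp add: TD u(2))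
    also have "\<dots> \<le> (norm u)\<^sup>2" by (intro power_mono T(2)) simp
    also have "\<dots> = (norm x)\<^sup>2 + (cmod z)\<^sup>2 * (norm (D u))\<^sup>2"
      by (simp add: pyth[of u] Lu uJ norm_scaleC power_mult_distrib)
    also have "\<dots> \<le> (norm x)\<^sup>2 + 1 * (norm (D u))\<^sup>2"
      using z by (intro add_left_mono mult_right_mono) (simp_all add: power_le_one)
    finally show ?thesis by simp
  qed
  have contr': "norm (\<Phi> z) \<le> 1" if "z \<in> ball 0 1" for z
    by (rule norm_blinfun_bound) (simp_all add: contr[OF that])
  have "\<Phi> \<in> Hinf"
    unfolding Hinf_def bounded_iff
    by (intro CollectI conjI exI[of _ A] exI[of _ 1]) (use sums A_mem contr' in \<open>auto simp del: mem_ball\<close>)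
  moreover have "\<Phi> z x = L (T u)" if z: "z \<in> ball 0 1" and u: "u = J x + z *\<^sub>C D u" for z x u
  proof -
    obtain v where v: "v = J x + z *\<^sub>C D v" "\<Phi> z x = L (T v)" using state[OF z] by blast
    \<comment> \<open>Solutions of the state equation are unique because $z D$ is a strict contraction.\<close>
    have "u - v = z *\<^sub>C D (u - v)"
      using u v(1) by (metis add_diff_cancel_left blinfun.diff_right scaleC_diff_right)
    then have "norm (u - v) \<le> cmod z * norm (u - v)"
      by (metis D_le mult_left_mono norm_ge_zero norm_scaleC)
    then have "(1 - cmod z) * norm (u - v) \<le> 0" by (simp add: algebra_simps)
    then have "u = v" using z by (simp add: mult_le_0_iff)
    then show ?thesis using v(2) by simp
  qed
  ultimately show ?thesis using contr' unfolding D by blast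
qed

section \<open>The quadratic form of the Pick matrix\<close>

text \<open>
  Expand each $1 / (1 - \overline{\lambda_i} \lambda_j)$ into a geometric series; for fixed \<open>m\<close> the double sum of the
  \<open>m\<close>-th terms is the square of a norm. Applied to the vectors $x_j$ and $W_j x_j$, this evaluates
  both parts of the form of the Pick matrix.
\<close>

lemma szego_form_sums:
  fixes x :: "nat \<Rightarrow> 'a::complex_hilbert"
  assumes lam: "\<And>i. i \<in> I \<Longrightarrow> lam i \<in> ball 0 1"
  shows "(\<lambda>m. complex_of_real ((norm (\<Sum>j\<in>I. lam j ^ m *\<^sub>C x j))\<^sup>2)) sums
    (\<Sum>i\<in>I. \<Sum>j\<in>I. cinner (x j) (x i) / (1 - cnj (lam i) * lam j))"
proof -
  have "complex_of_real ((norm (\<Sum>j\<in>I. lam j ^ m *\<^sub>C x j))\<^sup>2)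
      = (\<Sum>i\<in>I. \<Sum>j\<in>I. cinner (x j) (x i) * (cnj (lam i) * lam j) ^ m)" for m
    unfolding cinner_self[symmetric]
    unfolding cinner_sum_right unfolding cinner_sum_left
    by (intro sum.cong refl)
       (simp add: cinner_scaleC_left cinner_scaleC_right power_mult_distrib mult_ac)
  moreover have "(\<lambda>m. \<Sum>i\<in>I. \<Sum>j\<in>I. cinner (x j) (x i) * (cnj (lam i) * lam j) ^ m) sums
    (\<Sum>i\<in>I. \<Sum>j\<in>I. cinner (x j) (x i) * (1 / (1 - cnj (lam i) * lam j)))"
  proof (intro sums_sum sums_mult geometric_sums)
    fix i j assume "i \<in> I" "j \<in> I"
    then show "norm (cnj (lam i) * lam j) < 1"
      using lam[of i] lam[of j] mult_strict_mono'[of "cmod (lam i)" 1 "cmod (lam j)" 1]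
      by (simp add: norm_mult)
  qed
  ultimately show ?thesis by simp
qed

lemma cinner_pick_entry:
  fixes A B :: "'a::complex_hilbert \<Rightarrow>\<^sub>L 'a"
  assumes "A \<in> bounded_clinear_ops"
  shows "cinner ((c *\<^sub>C (id_blinfun - (cadjoint A o\<^sub>L B))) u) v
    = c * (cinner u v - cinner (B u) (A v))"
proof -
  have "cinner (cadjoint A (B u)) v = cinner (B u) (A v)"
    using cinner_cadjoint[OF assms, of v "B u"] cinner_commute by metis
  then show ?thesis
    by (simp add: cinner_scaleC_left blinfun.diff_left cinner_diff_left)
qed

section \<open>Toeplitz operators with contractive symbol\<close>

text \<open>
  With $\omega_l = e^{2 \pi i l / M}$ one has $\omega_l^k = \omega_k^l$, so this is a geometric sum in
  $q = \omega_k \overline{\omega_m}$, where $q^M = 1$, and $q = 1$ only for \<open>k = m\<close>.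
\<close>

lemma roots_of_unity_orthogonal:
  assumes "k < M" "m < M"
  shows "(\<Sum>l<M. cis (2 * pi * real l / real M) ^ k * cnj (cis (2 * pi * real l / real M) ^ m))
    = (if k = m then of_nat M else 0)"
proof -
  define w where "w k = cis (2 * pi * real k / real M)" for k
  have M: "M > 0" using assms by simp
  have swap: "w l ^ k = w k ^ l" for l k
    unfolding w_def Complex.DeMoivre by (simp add: mult_ac)
  have root: "w k ^ M = 1" for k
    using M by (simp add: w_def Complex.DeMoivre cis_multiple_2pi)
  define q where "q = w k * cnj (w m)"
  have "(\<Sum>l<M. w l ^ k * cnj (w l ^ m)) = (\<Sum>l<M. q ^ l)"
    by (simp add: swap[of _ k] swap[of _ m] q_def power_mult_distrib)
  also have "\<dots> = (if k = m then of_nat M else 0)"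
  proof (cases "k = m")
    case True
    have "q = 1" unfolding q_def True w_def by (simp add: cis_cnj cis_mult)
    then show ?thesis using True by simp
  next
    case False
    have "w k \<noteq> w m"
      using inj_onD[OF bij_betw_imp_inj_on[OF Complex.bij_betw_roots_unity[OF M]], of k m] assms False
      by (auto simp: w_def)
    moreover have "w m * cnj (w m) = 1" by (simp add: w_def cis_cnj cis_mult)
    ultimately have "q \<noteq> 1" unfolding q_def by (metis mult.assoc mult.commute mult_1)
    moreover have "q ^ M = 1" by (simp add: q_def power_mult_distrib root flip: complex_cnj_power)
    ultimately show ?thesis using False by (simp add: sum_gp_strict)
  qed
  finally show ?thesis by (simp add: w_def)
qed

lemma parseval_roots_of_unity:
  fixes b :: "nat \<Rightarrow> 'a::complex_hilbert"
  shows "(\<Sum>l<M. (norm (\<Sum>k<M. cis (2 * pi * real l / real M) ^ k *\<^sub>C b k))\<^sup>2)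
    = real M * (\<Sum>k<M. (norm (b k))\<^sup>2)"
proof -
  define w where "w l = cis (2 * pi * real l / real M)" for l
  have "complex_of_real (\<Sum>l<M. (norm (\<Sum>k<M. w l ^ k *\<^sub>C b k))\<^sup>2)
      = (\<Sum>l<M. \<Sum>k<M. \<Sum>m<M. (w l ^ k * cnj (w l ^ m)) * cinner (b k) (b m))"
    unfolding of_real_sum cinner_self[symmetric]
    unfolding cinner_sum_left unfolding cinner_sum_right
    by (simp add: cinner_scaleC_left cinner_scaleC_right mult_ac)
  also have "\<dots> = (\<Sum>k<M. \<Sum>l<M. \<Sum>m<M. (w l ^ k * cnj (w l ^ m)) * cinner (b k) (b m))"
    by (rule sum.swap)
  also have "\<dots> = (\<Sum>k<M. \<Sum>m<M. (\<Sum>l<M. w l ^ k * cnj (w l ^ m)) * cinner (b k) (b m))"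
    unfolding sum_distrib_right by (intro sum.cong refl sum.swap)
  also have "\<dots> = (\<Sum>k<M. \<Sum>m<M. if k = m then of_nat M * cinner (b k) (b m) else 0)"
    unfolding w_def by (intro sum.cong refl) (simp add: roots_of_unity_orthogonal del: complex_cnj_power)
  also have "\<dots> = complex_of_real (real M * (\<Sum>k<M. (norm (b k))\<^sup>2))"
    by (simp add: sum_distrib_left cinner_self)
  finally show ?thesis unfolding w_def of_real_eq_iff .
qed

text \<open>
  On a circle inside the disk the series converges uniformly: convergence at a real point between the
  circle and the boundary bounds the coefficients geometrically.
\<close>

lemma power_series_tail:
  fixes A :: "nat \<Rightarrow> 'a::complex_hilbert \<Rightarrow>\<^sub>L 'a"
  assumes sums: "\<And>z. z \<in> ball 0 1 \<Longrightarrow> (\<lambda>n. z ^ n *\<^sub>C A n) sums \<Phi> z" and r: "0 \<le> r" "r < 1"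
  shows "\<exists>e. e \<longlonglongrightarrow> 0 \<and> (\<forall>K z. cmod z = r \<longrightarrow> norm ((\<Sum>n<K. z ^ n *\<^sub>C A n) - \<Phi> z) \<le> e K)"
proof -
  \<comment> \<open>A radius strictly between \<open>r\<close> and the boundary.\<close>
  define s where "s = (1 + r) / 2"
  have s: "0 < s" "s < 1" "r < s" using r by (auto simp: s_def)
  have eq: "complex_of_real s ^ n *\<^sub>C A n = s ^ n *\<^sub>R A n" for n
    by (rule blinfun_eqI) (simp add: blinfun.scaleR_left scaleR_eq_scaleC)
  have "summable (\<lambda>n. s ^ n *\<^sub>R A n)"
    using sums[of "of_real s"] s by (simp add: eq sums_iff)
  then have "Bseq (\<lambda>n. s ^ n *\<^sub>R A n)"
    by (intro convergent_imp_Bseq convergentI[OF summable_LIMSEQ_zero])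
  then obtain B where B: "\<And>n. norm (s ^ n *\<^sub>R A n) \<le> B" unfolding Bseq_def by blast
  have A_le: "norm (A n) \<le> B / s ^ n" for n
    using B[of n] s by (simp add: field_simps)
  have abs: "summable (\<lambda>n. r ^ n * norm (A n))"
  proof (rule summable_comparison_test'[of "\<lambda>n. B * (r / s) ^ n" 0])
    show "summable (\<lambda>n. B * (r / s) ^ n)"
      using r s by (intro summable_mult summable_geometric) simp
    show "norm (r ^ n * norm (A n)) \<le> B * (r / s) ^ n" for n
      using mult_left_mono[OF A_le, of "r ^ n" n] r s by (simp add: power_divide field_simps)
  qed
  define e where "e K = (\<Sum>n. r ^ (n + K) * norm (A (n + K)))" for K
  have "norm ((\<Sum>n<K. z ^ n *\<^sub>C A n) - \<Phi> z) \<le> e K" if z: "cmod z = r" for K z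
  proof -
    have *: "(\<lambda>n. z ^ n *\<^sub>C A n) sums \<Phi> z" using z r by (intro sums) simp
    have le: "norm (z ^ n *\<^sub>C A n) \<le> r ^ n * norm (A n)" for n
      using norm_scaleC_blinfun_le[of "z ^ n" "A n"] by (simp add: norm_power z)
    have shift: "summable (\<lambda>n. r ^ (n + K) * norm (A (n + K)))"
      using abs by (rule summable_ignore_initial_segment)
    have "\<Phi> z - (\<Sum>n<K. z ^ n *\<^sub>C A n) = (\<Sum>n. z ^ (n + K) *\<^sub>C A (n + K))"
      using sums_split_initial_segment[OF *, of K] by (simp add: sums_iff)
    also have "norm \<dots> \<le> e K"
      unfolding e_def by (rule norm_suminf_le) (use le shift in auto)
    finally show ?thesis by (simp add: norm_minus_commute)
  qed
  moreover have "e \<longlonglongrightarrow> 0" unfolding e_def by (rule suminf_exist_split2[OF abs])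
  ultimately show ?thesis by blast
qed

text \<open>
  Replace \<open>\<Phi>\<close> by its \<open>K\<close>-th partial sum, whose norm on the circle of radius \<open>r\<close> is at most $1 + e_K$ with
  $e_K \to 0$. Its product with the polynomial $\sum_k z^k f_k$ is again a polynomial, and for
  \<open>K \<ge> N\<close> the first \<open>N\<close> coefficients are the convolutions on the left-hand side. Parseval's identity
  with \<open>K + N\<close> roots of unity, enough to separate all powers that occur, gives the estimate up to
  the factor $(1 + e_K)^2$.
\<close>

lemma contractive_symbol_on_circle:
  fixes A :: "nat \<Rightarrow> 'a::complex_hilbert \<Rightarrow>\<^sub>L 'a"
  assumes A: "\<And>n. A n \<in> bounded_clinear_ops"
    and sums: "\<And>z. z \<in> ball 0 1 \<Longrightarrow> (\<lambda>n. z ^ n *\<^sub>C A n) sums \<Phi> z"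
    and le1: "\<And>z. z \<in> ball 0 1 \<Longrightarrow> norm (\<Phi> z) \<le> 1"
    and r: "0 \<le> r" "r < 1" and f: "\<And>k. k \<ge> N \<Longrightarrow> f k = 0"
  shows "(\<Sum>k<N. (norm (r ^ k *\<^sub>R (\<Sum>n\<le>k. A n (f (k - n)))))\<^sup>2)
    \<le> (\<Sum>k<N. (norm (r ^ k *\<^sub>R f k))\<^sup>2)"
proof -
  obtain e where e: "e \<longlonglongrightarrow> 0"
    "\<And>K z. cmod z = r \<Longrightarrow> norm ((\<Sum>n<K. z ^ n *\<^sub>C A n) - \<Phi> z) \<le> e K"
    using power_series_tail[OF sums r] by metis
  \<comment> \<open>The coefficients of the product of the \<open>K\<close>-th partial sum with the polynomial.\<close>
  define b where "b K k = (\<Sum>n<K. if n \<le> k then A n (f (k - n)) else 0)" for K k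
  have prod: "(\<Sum>n<K. z ^ n *\<^sub>C A n) (\<Sum>j<K+N. z ^ j *\<^sub>C f j) = (\<Sum>k<K+N. z ^ k *\<^sub>C b K k)" for K z
  proof -
    have "(\<Sum>j<K+N. z ^ (n + j) *\<^sub>C A n (f j))
        = (\<Sum>k<K+N. z ^ k *\<^sub>C (if n \<le> k then A n (f (k - n)) else 0))" if "n < K" for n
    proof -
      have "(\<Sum>k<K+N. z ^ k *\<^sub>C (if n \<le> k then A n (f (k - n)) else 0))
          = (\<Sum>k\<in>{n..<K+N}. z ^ k *\<^sub>C A n (f (k - n)))"
        by (rule sum.mono_neutral_cong_right) auto
      also have "\<dots> = (\<Sum>j<K+N-n. z ^ (n + j) *\<^sub>C A n (f j))"
        by (rule sum.reindex_bij_witness[of _ "\<lambda>j. n + j" "\<lambda>k. k - n"]) auto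
      also have "\<dots> = (\<Sum>j<K+N. z ^ (n + j) *\<^sub>C A n (f j))"
        by (rule sum.mono_neutral_left) (use that f in auto)
      finally show ?thesis by simp
    qed
    then have "(\<Sum>n<K. \<Sum>j<K+N. z ^ (n + j) *\<^sub>C A n (f j)) = (\<Sum>k<K+N. z ^ k *\<^sub>C b K k)"
      by (simp add: b_def scaleC_sum_right sum.swap[of _ "{..<K}"])
    then show ?thesis
      unfolding blinfun.sum_left unfolding blinfun.sum_right
      using A by (simp add: bounded_clinear_ops_def
          scaleC_scaleC scaleC_sum_right power_add mult.commute)
  qed
  have fin: "(\<Sum>k<N. (norm (r ^ k *\<^sub>R (\<Sum>n\<le>k. A n (f (k - n)))))\<^sup>2)
      \<le> (1 + e K)\<^sup>2 * (\<Sum>k<N. (norm (r ^ k *\<^sub>R f k))\<^sup>2)" if K: "K \<ge> N" "0 < K" for K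
  proof -
    define M where "M = K + N"
    have M: "M > 0" using K by (simp add: M_def)
    define w where "w l = cis (2 * pi * real l / real M)" for l
    have pars: "(\<Sum>l<M. (norm (\<Sum>k<M. (of_real r * w l) ^ k *\<^sub>C g k))\<^sup>2)
        = real M * (\<Sum>k<M. (norm (r ^ k *\<^sub>R g k))\<^sup>2)" for g :: "nat \<Rightarrow> 'a"
    proof -
      have "(of_real r * w l) ^ k *\<^sub>C g k = w l ^ k *\<^sub>C (r ^ k *\<^sub>R g k)" for l k
        by (simp add: scaleR_eq_scaleC scaleC_scaleC power_mult_distrib mult.commute)
      then show ?thesis
        using parseval_roots_of_unity[of M "\<lambda>k. r ^ k *\<^sub>R g k"] by (simp add: w_def)
    qed
    have pt: "(norm (\<Sum>k<M. z ^ k *\<^sub>C b K k))\<^sup>2 \<le> (1 + e K)\<^sup>2 * (norm (\<Sum>k<M. z ^ k *\<^sub>C f k))\<^sup>2"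
      if z: "cmod z = r" for z
    proof -
      have "norm (\<Sum>n<K. z ^ n *\<^sub>C A n) \<le> norm (\<Phi> z) + norm ((\<Sum>n<K. z ^ n *\<^sub>C A n) - \<Phi> z)"
        by (rule norm_triangle_sub)
      also have "\<dots> \<le> 1 + e K" using le1[of z] e(2)[OF z, of K] z r by simp
      finally have "norm (\<Sum>n<K. z ^ n *\<^sub>C A n) * norm (\<Sum>k<M. z ^ k *\<^sub>C f k)
          \<le> (1 + e K) * norm (\<Sum>k<M. z ^ k *\<^sub>C f k)"
        by (rule mult_right_mono) simp
      then have "norm (\<Sum>k<M. z ^ k *\<^sub>C b K k) \<le> (1 + e K) * norm (\<Sum>k<M. z ^ k *\<^sub>C f k)"
        using norm_blinfun[of "\<Sum>n<K. z ^ n *\<^sub>C A n" "\<Sum>k<M. z ^ k *\<^sub>C f k"]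
        unfolding M_def prod by linarith
      then have "(norm (\<Sum>k<M. z ^ k *\<^sub>C b K k))\<^sup>2 \<le> ((1 + e K) * norm (\<Sum>k<M. z ^ k *\<^sub>C f k))\<^sup>2"
        by (rule power_mono) simp
      then show ?thesis by (simp add: power_mult_distrib)
    qed
    have "real M * (\<Sum>k<M. (norm (r ^ k *\<^sub>R b K k))\<^sup>2)
        \<le> (\<Sum>l<M. (1 + e K)\<^sup>2 * (norm (\<Sum>k<M. (of_real r * w l) ^ k *\<^sub>C f k))\<^sup>2)"
      unfolding pars[symmetric]
      by (intro sum_mono pt) (use r in \<open>simp add: norm_mult w_def\<close>)
    also have "\<dots> = real M * ((1 + e K)\<^sup>2 * (\<Sum>k<M. (norm (r ^ k *\<^sub>R f k))\<^sup>2))"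
      by (simp add: pars flip: sum_distrib_left)
    finally have *: "(\<Sum>k<M. (norm (r ^ k *\<^sub>R b K k))\<^sup>2) \<le> (1 + e K)\<^sup>2 * (\<Sum>k<M. (norm (r ^ k *\<^sub>R f k))\<^sup>2)"
      using M by simp
    have "b K k = (\<Sum>n\<le>k. A n (f (k - n)))" if "k < N" for k
      unfolding b_def by (rule sum.mono_neutral_cong_right) (use that K in auto)
    then have "(\<Sum>k<N. (norm (r ^ k *\<^sub>R (\<Sum>n\<le>k. A n (f (k - n)))))\<^sup>2) = (\<Sum>k<N. (norm (r ^ k *\<^sub>R b K k))\<^sup>2)"
      by simp
    also have "\<dots> \<le> (\<Sum>k<M. (norm (r ^ k *\<^sub>R b K k))\<^sup>2)"
      by (rule sum_mono2) (auto simp: M_def)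
    also note *
    also have "(\<Sum>k<M. (norm (r ^ k *\<^sub>R f k))\<^sup>2) = (\<Sum>k<N. (norm (r ^ k *\<^sub>R f k))\<^sup>2)"
      by (rule sum.mono_neutral_right) (auto simp: M_def f)
    finally show ?thesis .
  qed
  have "(\<lambda>K. (1 + e K)\<^sup>2 * (\<Sum>k<N. (norm (r ^ k *\<^sub>R f k))\<^sup>2))
      \<longlonglongrightarrow> (1 + 0)\<^sup>2 * (\<Sum>k<N. (norm (r ^ k *\<^sub>R f k))\<^sup>2)"
    by (intro tendsto_intros e(1))
  then have "(\<Sum>k<N. (norm (r ^ k *\<^sub>R (\<Sum>n\<le>k. A n (f (k - n)))))\<^sup>2)
      \<le> (1 + 0)\<^sup>2 * (\<Sum>k<N. (norm (r ^ k *\<^sub>R f k))\<^sup>2)"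
    by (rule LIMSEQ_le_const) (intro exI[of _ "Suc N"] allI impI fin, simp_all)
  then show ?thesis by simp
qed

text \<open>
  The preceding estimate with $r \to 1$ and the order of the entries reversed: as coefficients of a
  polynomial, $y$ is listed from the highest power down, which turns the correlation
  $\sum_n A_n y_{m+n}$ into a convolution.
\<close>

lemma contractive_symbol_finite_toeplitz:
  fixes A :: "nat \<Rightarrow> 'a::complex_hilbert \<Rightarrow>\<^sub>L 'a"
  assumes A: "\<And>n. A n \<in> bounded_clinear_ops"
    and sums: "\<And>z. z \<in> ball 0 1 \<Longrightarrow> (\<lambda>n. z ^ n *\<^sub>C A n) sums \<Phi> z"
    and le1: "\<And>z. z \<in> ball 0 1 \<Longrightarrow> norm (\<Phi> z) \<le> 1"
  shows "(\<Sum>m<N. (norm (\<Sum>n<N - m. A n (y (m + n))))\<^sup>2) \<le> (\<Sum>m<N. (norm (y m))\<^sup>2)"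
proof -
  define f where "f k = (if k < N then y (N - Suc k) else 0)" for k
  have "(\<Sum>k<N. (norm (1 ^ k *\<^sub>R (\<Sum>n\<le>k. A n (f (k - n)))))\<^sup>2)
      \<le> (\<Sum>k<N. (norm (1 ^ k *\<^sub>R f k))\<^sup>2)"
  proof (rule tendsto_le[of "at_left 1"])
    show "((\<lambda>r. \<Sum>k<N. (norm (r ^ k *\<^sub>R f k))\<^sup>2) \<longlongrightarrow> (\<Sum>k<N. (norm (1 ^ k *\<^sub>R f k))\<^sup>2)) (at_left (1::real))"
      "((\<lambda>r. \<Sum>k<N. (norm (r ^ k *\<^sub>R (\<Sum>n\<le>k. A n (f (k - n)))))\<^sup>2) \<longlongrightarrow>
        (\<Sum>k<N. (norm (1 ^ k *\<^sub>R (\<Sum>n\<le>k. A n (f (k - n)))))\<^sup>2)) (at_left (1::real))"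
      by (intro tendsto_intros)+
    have "\<forall>\<^sub>F r in at_left (1::real). r \<in> {0<..<1}"
      by (rule eventually_at_leftI[of 0]) auto
    then show "\<forall>\<^sub>F r in at_left (1::real). (\<Sum>k<N. (norm (r ^ k *\<^sub>R (\<Sum>n\<le>k. A n (f (k - n)))))\<^sup>2)
      \<le> (\<Sum>k<N. (norm (r ^ k *\<^sub>R f k))\<^sup>2)"
      by eventually_elim (intro contractive_symbol_on_circle[OF A sums le1], auto simp: f_def)
  qed simp
  moreover have "(\<Sum>k<N. (norm (\<Sum>n\<le>k. A n (f (k - n))))\<^sup>2)
      = (\<Sum>m<N. (norm (\<Sum>n<N - m. A n (y (m + n))))\<^sup>2)"
  proof (rule sum.reindex_bij_witness[of _ "\<lambda>m. N - Suc m" "\<lambda>k. N - Suc k"])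
    fix k assume k: "k \<in> {..<N}"
    have "(\<Sum>n<N - (N - Suc k). A n (y (N - Suc k + n))) = (\<Sum>n\<le>k. A n (f (k - n)))"
      by (rule sum.cong) (use k in \<open>auto simp: f_def intro!: arg_cong[where f=y] arg_cong[where f="blinfun_apply _"]\<close>)
    then show "(norm (\<Sum>n<N - (N - Suc k). A n (y (N - Suc k + n))))\<^sup>2
        = (norm (\<Sum>n\<le>k. A n (f (k - n))))\<^sup>2" by simp
  qed auto
  moreover have "(\<Sum>k<N. (norm (f k))\<^sup>2) = (\<Sum>m<N. (norm (y m))\<^sup>2)"
    by (rule sum.reindex_bij_witness[of _ "\<lambda>m. N - Suc m" "\<lambda>k. N - Suc k"]) (auto simp: f_def)
  ultimately show ?thesis by simp
qed

text \<open>
  The limit of the finite sections, taken first in the length of the inner sums and then in the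
  number of outer terms.
\<close>

lemma contractive_symbol_toeplitz:
  fixes A :: "nat \<Rightarrow> 'a::complex_hilbert \<Rightarrow>\<^sub>L 'a"
  assumes A: "\<And>n. A n \<in> bounded_clinear_ops"
    and sums: "\<And>z. z \<in> ball 0 1 \<Longrightarrow> (\<lambda>n. z ^ n *\<^sub>C A n) sums \<Phi> z"
    and le1: "\<And>z. z \<in> ball 0 1 \<Longrightarrow> norm (\<Phi> z) \<le> 1"
    and y: "(\<lambda>m. (norm (y m))\<^sup>2) sums s" and w: "\<And>m. (\<lambda>n. A n (y (m + n))) sums w m"
    and w2: "(\<lambda>m. (norm (w m))\<^sup>2) sums t"
  shows "t \<le> s"
proof -
  have "(\<Sum>m<M. (norm (w m))\<^sup>2) \<le> s" for M
  proof (rule tendsto_upperbound)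
    have "(\<lambda>N. \<Sum>n<N - m. A n (y (m + n))) \<longlonglongrightarrow> w m" for m
      using w[of m] unfolding sums_def by (rule filterlim_compose) (rule filterlim_minus_const_nat_at_top)
    then show "(\<lambda>N. \<Sum>m<M. (norm (\<Sum>n<N - m. A n (y (m + n))))\<^sup>2) \<longlonglongrightarrow> (\<Sum>m<M. (norm (w m))\<^sup>2)"
      by (intro tendsto_intros)
    show "\<forall>\<^sub>F N in sequentially. (\<Sum>m<M. (norm (\<Sum>n<N - m. A n (y (m + n))))\<^sup>2) \<le> s"
    proof (rule eventually_sequentiallyI[of M])
      fix N assume "M \<le> N"
      then have "(\<Sum>m<M. (norm (\<Sum>n<N - m. A n (y (m + n))))\<^sup>2)
          \<le> (\<Sum>m<N. (norm (\<Sum>n<N - m. A n (y (m + n))))\<^sup>2)"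
        by (intro sum_mono2) auto
      also have "\<dots> \<le> (\<Sum>m<N. (norm (y m))\<^sup>2)"
        by (rule contractive_symbol_finite_toeplitz[OF A sums le1])
      also have "\<dots> \<le> s"
        using sum_le_suminf[of "\<lambda>m. (norm (y m))\<^sup>2" "{..<N}"] y by (simp add: sums_iff)
      finally show "(\<Sum>m<M. (norm (\<Sum>n<N - m. A n (y (m + n))))\<^sup>2) \<le> s" .
    qed
  qed simp
  then show ?thesis using w2 by (auto simp: sums_iff intro: suminf_le_const)
qed

text \<open>
  The interpolation conditions make the sequence $(\sum_j \lambda_j^m W_j x_j)_m$ the image of
  $(\sum_j \lambda_j^m x_j)_m$ under the Toeplitz operator with symbol \<open>\<Phi>\<close>.
\<close>

lemma contractive_interpolant_imp_pick_positive:
  fixes W :: "nat \<Rightarrow> 'a::complex_hilbert \<Rightarrow>\<^sub>L 'a"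
  assumes lam: "\<And>i. i \<in> {1..d} \<Longrightarrow> lam i \<in> ball 0 1"
    and W: "\<And>i. i \<in> {1..d} \<Longrightarrow> W i \<in> bounded_clinear_ops"
    and A: "\<And>n. A n \<in> bounded_clinear_ops"
    and sums: "\<And>z. z \<in> ball 0 1 \<Longrightarrow> (\<lambda>n. z ^ n *\<^sub>C A n) sums \<Phi> z"
    and le1: "\<And>z. z \<in> ball 0 1 \<Longrightarrow> norm (\<Phi> z) \<le> 1"
    and interp: "\<And>i. i \<in> {1..d} \<Longrightarrow> \<Phi> (lam i) = W i"
  shows "block_positive d
    (\<lambda>i j. (1 / (1 - cnj (lam i) * lam j)) *\<^sub>C (id_blinfun - (cadjoint (W i) o\<^sub>L W j)))"
  unfolding block_positive_def
proof
  fix x :: "nat \<Rightarrow> 'a"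
  define I where "I = {1..d}"
  define y where "y m = (\<Sum>j\<in>I. lam j ^ m *\<^sub>C x j)" for m
  define w where "w m = (\<Sum>j\<in>I. lam j ^ m *\<^sub>C W j (x j))" for m
  define p where "p = (\<Sum>i\<in>I. \<Sum>j\<in>I. cinner (x j) (x i) / (1 - cnj (lam i) * lam j))"
  define q where "q = (\<Sum>i\<in>I. \<Sum>j\<in>I. cinner (W j (x j)) (W i (x i)) / (1 - cnj (lam i) * lam j))"
  have p: "(\<lambda>m. complex_of_real ((norm (y m))\<^sup>2)) sums p"
    unfolding y_def p_def by (rule szego_form_sums) (rule lam, simp add: I_def)
  have q: "(\<lambda>m. complex_of_real ((norm (w m))\<^sup>2)) sums q"
    unfolding w_def q_def by (rule szego_form_sums) (rule lam, simp add: I_def)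
  have "(\<lambda>n. A n (y (m + n))) sums w m" for m
  proof -
    have "(\<lambda>n. \<Sum>j\<in>I. lam j ^ m *\<^sub>C (lam j ^ n *\<^sub>C A n) (x j)) sums
        (\<Sum>j\<in>I. lam j ^ m *\<^sub>C \<Phi> (lam j) (x j))"
      by (intro sums_sum bounded_linear.sums[OF bounded_linear_scaleC]
          bounded_linear.sums[OF blinfun.bounded_linear_left] sums) (use lam in \<open>simp add: I_def\<close>)
    moreover have "(\<Sum>j\<in>I. lam j ^ m *\<^sub>C (lam j ^ n *\<^sub>C A n) (x j)) = A n (y (m + n))" for n
      using A by (simp add: y_def blinfun.sum_right bounded_clinear_ops_def scaleC_scaleC power_add)
    ultimately show ?thesis by (simp add: w_def interp I_def)
  qed
  then have "Re q \<le> Re p"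
    using contractive_symbol_toeplitz[OF A sums le1 _ _ sums_Re[OF q, simplified]] sums_Re[OF p] by simp
  moreover have "Im p = 0" "Im q = 0"
    using sums_Im[OF p] sums_Im[OF q] by (simp_all add: sums_iff)
  ultimately have "p - q \<in> \<real>\<^sub>\<ge>\<^sub>0" by (simp add: complex_nonneg_Reals_iff)
  moreover have "(\<Sum>i\<in>I. \<Sum>j\<in>I. cinner (((1 / (1 - cnj (lam i) * lam j)) *\<^sub>C
      (id_blinfun - (cadjoint (W i) o\<^sub>L W j))) (x j)) (x i)) = p - q"
    unfolding p_def q_def sum_subtractf[symmetric]
    by (intro sum.cong refl, subst cinner_pick_entry) (simp_all add: W I_def diff_divide_distrib)
  ultimately show "(\<Sum>i\<in>{1..d}. \<Sum>j\<in>{1..d}. cinner (((1 / (1 - cnj (lam i) * lam j)) *\<^sub>C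
      (id_blinfun - (cadjoint (W i) o\<^sub>L W j))) (x j)) (x i)) \<in> \<real>\<^sub>\<ge>\<^sub>0"
    by (simp add: I_def)
qed

section \<open>Construction of the interpolant\<close>

text \<open>
  The block matrix \<open>P\<close> acts on $E^d$, realised as the entries with index in \<open>{1..d}\<close> of a sequence in
  $\ell^2(E)$, and is factored there as a positive operator.
\<close>

lemma block_positive_factorization:
  fixes P :: "nat \<Rightarrow> nat \<Rightarrow> 'a::complex_hilbert \<Rightarrow>\<^sub>L 'a"
  assumes P: "\<And>i j. i \<in> {1..d} \<Longrightarrow> j \<in> {1..d} \<Longrightarrow> P i j \<in> bounded_clinear_ops"
    and herm: "\<And>i j x y. i \<in> {1..d} \<Longrightarrow> j \<in> {1..d} \<Longrightarrow> inner (P i j x) y = inner x (P j i y)"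
    and pos: "block_positive d P"
  shows "\<exists>R :: 'a ell2 \<Rightarrow> 'a ell2 ell2. linear R \<and> (\<forall>c f. R (c *\<^sub>C f) = c *\<^sub>C R f) \<and>
    (\<forall>f. coord (R f) 0 = 0) \<and>
    (\<forall>f. (norm (R f))\<^sup>2 = (\<Sum>i\<in>{1..d}. \<Sum>j\<in>{1..d}. inner (P i j (coord f j)) (coord f i)))"
proof -
  define Pf where "Pf f = (\<Sum>i\<in>{1..d}. \<Sum>j\<in>{1..d}. ell2_single i (P i j (coord f j)))" for f
  have "bounded_linear Pf"
    unfolding Pf_def
    by (intro bounded_linear_sum bounded_linear_compose[OF bounded_linear_single]
        bounded_linear_compose[OF blinfun.bounded_linear_right] bounded_linear_coord)
  then have B: "blinfun_apply (Blinfun Pf) = Pf" by (rule bounded_linear_Blinfun_apply)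
  have form: "inner (Pf f) g = (\<Sum>i\<in>{1..d}. \<Sum>j\<in>{1..d}. inner (P i j (coord f j)) (coord g i))" for f g
    by (simp add: Pf_def inner_sum_left inner_single)
  have hom: "Blinfun Pf \<in> bounded_clinear_ops"
    using P by (simp add: bounded_clinear_ops_def B Pf_def scaleC_sum_right single_scaleC)
  have sym: "inner (Pf f) g = inner f (Pf g)" for f g
  proof -
    have "inner (Pf f) g = (\<Sum>i\<in>{1..d}. \<Sum>j\<in>{1..d}. inner (P j i (coord g i)) (coord f j))"
      unfolding form by (intro sum.cong refl) (metis herm inner_commute)
    also have "\<dots> = inner (Pf g) f" unfolding form by (rule sum.swap)
    finally show ?thesis by (simp add: inner_commute)
  qed
  have "0 \<le> inner (Pf f) f" for f
  proof -
    have "(\<Sum>i\<in>{1..d}. \<Sum>j\<in>{1..d}. cinner (P i j (coord f j)) (coord f i)) \<in> \<real>\<^sub>\<ge>\<^sub>0"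
      using pos unfolding block_positive_def by blast
    then show ?thesis unfolding form by (simp add: complex_nonneg_Reals_iff inner_eq_Re_cinner)
  qed
  from positive_operator_factorization[of "Blinfun Pf", unfolded B, OF hom sym this]
  show ?thesis unfolding form .
qed

text \<open>
  The lurking isometry: the definition of \<open>P\<close> gives \<open>norm (V f) = norm (U f)\<close>, the contraction \<open>T\<close> with
  \<open>T (U f) = V f\<close> serves as system matrix, and \<open>U f\<close> for a sequence \<open>f\<close> with a single nonzero entry, at
  \<open>i\<close>, solves the state equation at $z = \lambda_i$.
\<close>

lemma pick_positive_imp_contractive_interpolant:
  fixes W :: "nat \<Rightarrow> 'a::complex_hilbert \<Rightarrow>\<^sub>L 'a"
  assumes lam: "\<And>i. i \<in> {1..d} \<Longrightarrow> lam i \<in> ball 0 1"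
    and W: "\<And>i. i \<in> {1..d} \<Longrightarrow> W i \<in> bounded_clinear_ops"
    and pos: "block_positive d
      (\<lambda>i j. (1 / (1 - cnj (lam i) * lam j)) *\<^sub>C (id_blinfun - (cadjoint (W i) o\<^sub>L W j)))"
  shows "\<exists>\<Phi>\<in>Hinf. (\<forall>z\<in>ball 0 1. norm (\<Phi> z) \<le> 1) \<and> (\<forall>i\<in>{1..d}. \<Phi> (lam i) = W i)"
proof -
  define P where "P i j = (1 / (1 - cnj (lam i) * lam j)) *\<^sub>C
    (id_blinfun - (cadjoint (W i) o\<^sub>L W j))" for i j
  have Wc: "W i (c *\<^sub>C x) = c *\<^sub>C W i x" if "i \<in> {1..d}" for i c x
    using W[OF that] by (simp add: bounded_clinear_ops_def)
  have entry: "cinner (P i j u) v = (cinner u v - cinner (W j u) (W i v)) / (1 - cnj (lam i) * lam j)"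
    if "i \<in> {1..d}" for i j u v
    unfolding P_def cinner_pick_entry[OF W[OF that]] by simp
  have P_mem: "P i j \<in> bounded_clinear_ops" if "i \<in> {1..d}" "j \<in> {1..d}" for i j
    unfolding bounded_clinear_ops_def
  proof (intro CollectI allI)
    fix c x
    have "inner (P i j (c *\<^sub>C x)) y = inner (c *\<^sub>C P i j x) y" for y
      unfolding inner_eq_Re_cinner
      by (simp add: entry[OF that(1)] Wc[OF that(2)] cinner_scaleC_left right_diff_distrib)
    then show "P i j (c *\<^sub>C x) = c *\<^sub>C P i j x" using vector_eq_rdot by blast
  qed
  have herm: "inner (P i j x) y = inner x (P j i y)" if "i \<in> {1..d}" "j \<in> {1..d}" for i j x y
  proof -
    have "cinner (P i j x) y = cnj (cinner (P j i y) x)"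
      unfolding entry[OF that(1)] entry[OF that(2)]
      by (simp add: mult.commute flip: cinner_commute)
    then show ?thesis by (simp add: inner_eq_Re_cinner cinner_commute[of x])
  qed
  obtain R :: "'a ell2 \<Rightarrow> 'a ell2 ell2" where R: "linear R" "\<And>c f. R (c *\<^sub>C f) = c *\<^sub>C R f"
    "\<And>f. coord (R f) 0 = 0"
    "\<And>f. (norm (R f))\<^sup>2 = (\<Sum>i\<in>{1..d}. \<Sum>j\<in>{1..d}. inner (P i j (coord f j)) (coord f i))"
    using block_positive_factorization[of d P] P_mem herm pos unfolding P_def by blast
  define J :: "'a \<Rightarrow>\<^sub>L 'a ell2 ell2" where "J = Blinfun (\<lambda>x. ell2_single 0 (ell2_single 0 x))"
  define L :: "'a ell2 ell2 \<Rightarrow>\<^sub>L 'a" where "L = Blinfun (\<lambda>g. coord (coord g 0) 0)"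
  have J: "J x = ell2_single 0 (ell2_single 0 x)" for x
    unfolding J_def
    by (subst bounded_linear_Blinfun_apply)
       (intro bounded_linear_compose[OF bounded_linear_single bounded_linear_single] refl)+
  have L: "L g = coord (coord g 0) 0" for g
    unfolding L_def
    by (subst bounded_linear_Blinfun_apply)
       (intro bounded_linear_compose[OF bounded_linear_coord bounded_linear_coord] refl)+
  have LJ: "L (J x) = x" for x by (simp add: J L)
  have LR: "L (R f) = 0" for f by (simp add: L R(3))
  have inner_J: "inner (J x) g = inner x (L g)" for x g by (simp add: J L inner_single)
  have norm_sum: "(norm (J x + g))\<^sup>2 = (norm x)\<^sup>2 + (norm g)\<^sup>2" if "L g = 0" for x g
    using that by (simp add: power2_norm_eq_inner inner_add_left inner_add_right inner_J LJ
        inner_commute[of g "J x"])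
  have pyth: "(norm g)\<^sup>2 = (norm (L g))\<^sup>2 + (norm (g - J (L g)))\<^sup>2" for g
    using norm_sum[of "g - J (L g)" "L g"] by (simp add: blinfun.diff_right LJ)

  define \<Lambda> where "\<Lambda> f = (\<Sum>j\<in>{1..d}. ell2_single j (lam j *\<^sub>C coord f j))" for f :: "'a ell2"
  have \<Lambda>: "coord (\<Lambda> f) j = lam j *\<^sub>C coord f j" if "j \<in> {1..d}" for f j
  proof -
    have "coord (\<Lambda> f) j = (\<Sum>k\<in>{1..d}. coord (ell2_single k (lam k *\<^sub>C coord f k)) j)"
      unfolding \<Lambda>_def
      by (rule linear_sum[OF bounded_linear.linear[OF bounded_linear_coord]])
    also have "\<dots> = (\<Sum>k\<in>{1..d}. if k = j then lam j *\<^sub>C coord f j else 0)"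
      by (rule sum.cong) auto
    also have "\<dots> = lam j *\<^sub>C coord f j" using that by simp
    finally show ?thesis .
  qed
  have lin\<Lambda>: "linear \<Lambda>"
    unfolding \<Lambda>_def
    by (intro bounded_linear.linear bounded_linear_sum bounded_linear_compose[OF bounded_linear_single]
        bounded_linear_compose[OF bounded_linear_scaleC] bounded_linear_coord)
  have hom\<Lambda>: "\<Lambda> (c *\<^sub>C f) = c *\<^sub>C \<Lambda> f" for c f
    by (simp add: \<Lambda>_def scaleC_sum_right scaleC_scaleC mult.commute flip: single_scaleC)
  define U where "U f = J (\<Sum>j\<in>{1..d}. coord f j) + R (\<Lambda> f)" for f
  define V where "V f = J (\<Sum>j\<in>{1..d}. W j (coord f j)) + R f" for f
  have "linear (\<lambda>f. J (\<Sum>j\<in>{1..d}. coord f j))" "linear (\<lambda>f. J (\<Sum>j\<in>{1..d}. W j (coord f j)))"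
    by (intro bounded_linear.linear bounded_linear_compose[OF blinfun.bounded_linear_right]
        bounded_linear_sum bounded_linear_coord)+
  then have lin: "linear U" "linear V"
    unfolding U_def V_def using linear_compose[OF lin\<Lambda> R(1)] R(1)
    by (auto intro: linear_compose_add simp: o_def)
  have homJ: "J (c *\<^sub>C x) = c *\<^sub>C J x" for c x by (simp add: J single_scaleC)
  have hom: "U (c *\<^sub>C f) = c *\<^sub>C U f" "V (c *\<^sub>C f) = c *\<^sub>C V f" for c f
    by (simp_all add: U_def V_def R(2) hom\<Lambda> scaleC_add_right Wc flip: homJ scaleC_sum_right)
  have iso: "(norm (V f))\<^sup>2 = (norm (U f))\<^sup>2" for f
  proof -
    let ?x = "coord f"
    \<comment> \<open>Passing from \<open>f\<close> to \<open>\<Lambda> f\<close> multiplies the \<open>(i, j)\<close> term by $\overline{\lambda_i} \lambda_j$, so the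
      difference cancels the denominator of the Pick matrix.\<close>
    have key: "inner (P i j (?x j)) (?x i) - inner (P i j (coord (\<Lambda> f) j)) (coord (\<Lambda> f) i)
        = Re (cinner (?x j) (?x i) - cinner (W j (?x j)) (W i (?x i)))"
      if ij: "i \<in> {1..d}" "j \<in> {1..d}" for i j
    proof -
      have "cmod (cnj (lam i) * lam j) < 1"
        using lam[OF ij(1)] lam[OF ij(2)] mult_strict_mono'[of "cmod (lam i)" 1 "cmod (lam j)" 1]
        by (simp add: norm_mult)
      then have nz: "1 - cnj (lam i) * lam j \<noteq> 0" by auto
      have "cinner (P i j (?x j)) (?x i) - cinner (P i j (coord (\<Lambda> f) j)) (coord (\<Lambda> f) i)
          = (1 - cnj (lam i) * lam j) * cinner (P i j (?x j)) (?x i)"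
        using P_mem[OF ij]
        by (simp add: \<Lambda>[OF ij(1)] \<Lambda>[OF ij(2)] bounded_clinear_ops_def cinner_scaleC_left cinner_scaleC_right algebra_simps)
      also have "\<dots> = cinner (?x j) (?x i) - cinner (W j (?x j)) (W i (?x i))"
        using nz by (simp add: entry[OF ij(1)])
      finally show ?thesis by (simp add: inner_eq_Re_cinner flip: minus_complex.sel)
    qed
    have "(norm (R f))\<^sup>2 - (norm (R (\<Lambda> f)))\<^sup>2
        = (\<Sum>i\<in>{1..d}. \<Sum>j\<in>{1..d}. Re (cinner (?x j) (?x i) - cinner (W j (?x j)) (W i (?x i))))"
      unfolding R(4) sum_subtractf[symmetric] by (intro sum.cong refl key)
    also have "\<dots> = (norm (\<Sum>j\<in>{1..d}. ?x j))\<^sup>2 - (norm (\<Sum>j\<in>{1..d}. W j (?x j)))\<^sup>2"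
      unfolding power2_norm_eq_inner inner_sum_right unfolding inner_sum_left
      by (simp add: sum_subtractf inner_eq_Re_cinner)
    finally show ?thesis by (simp add: U_def V_def norm_sum LR)
  qed
  then have "norm (V f) \<le> norm (U f)" for f
    by (rule power2_le_imp_le[OF eq_refl]) simp
  then obtain T :: "'a ell2 ell2 \<Rightarrow>\<^sub>L 'a ell2 ell2" where T: "T \<in> bounded_clinear_ops"
    "\<And>g. norm (T g) \<le> norm g" "\<And>f. T (U f) = V f"
    using contraction_factorization[OF lin(1) hom(1) lin(2) hom(2)] by blast
  obtain \<Phi> :: "complex \<Rightarrow> 'a \<Rightarrow>\<^sub>L 'a" where \<Phi>: "\<Phi> \<in> Hinf" "\<And>z. z \<in> ball 0 1 \<Longrightarrow> norm (\<Phi> z) \<le> 1"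
    "\<And>z x u. z \<in> ball 0 1 \<Longrightarrow> u = J x + z *\<^sub>C (T u - J (L (T u))) \<Longrightarrow> \<Phi> z x = L (T u)"
    using transfer_function_Hinf[OF T(1,2) homJ _ LJ pyth] L by auto
  have "\<Phi> (lam i) = W i" if i: "i \<in> {1..d}" for i
  proof (rule blinfun_eqI)
    fix x :: 'a
    define f where "f = ell2_single i x"
    have f: "coord f j = (if j = i then x else 0)" for j by (simp add: f_def)
    have sums: "(\<Sum>j\<in>{1..d}. coord f j) = x" "(\<Sum>j\<in>{1..d}. W j (coord f j)) = W i x"
      using i by (simp_all add: f if_distrib cong: if_cong)
    have "\<Lambda> f = (\<Sum>j\<in>{1..d}. if j = i then lam i *\<^sub>C f else 0)"
      unfolding \<Lambda>_def
      by (intro sum.cong refl) (auto simp: f f_def single_scaleC ell2_eqI)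
    then have "\<Lambda> f = lam i *\<^sub>C f" using i by simp
    then have Uf: "U f = J x + lam i *\<^sub>C R f" unfolding U_def sums by (simp add: R(2))
    have TUf: "T (U f) = J (W i x) + R f" unfolding T(3) V_def sums ..
    have LTUf: "L (T (U f)) = W i x" by (simp add: TUf blinfun.add_right LJ LR)
    have "U f = J x + lam i *\<^sub>C (T (U f) - J (L (T (U f))))"
      unfolding LTUf unfolding TUf by (simp add: Uf)
    from \<Phi>(3)[OF lam[OF i] this] show "\<Phi> (lam i) x = W i x" unfolding LTUf .
  qed
  then show ?thesis using \<Phi>(1,2) by blast
qed

section \<open>The interpolation theorem\<close>

theorem theorem2p5:
  fixes d :: nat
    and lam :: "nat \<Rightarrow> complex"
    and W :: "nat \<Rightarrow> 'a::complex_hilbert \<Rightarrow>\<^sub>L 'a"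
  assumes separable: "separable_space (euclidean :: 'a topology)"
    and nodes: "\<And>i. i \<in> {1..d} \<Longrightarrow> lam i \<in> ball 0 1"
    and targets: "\<And>i. i \<in> {1..d} \<Longrightarrow> W i \<in> bounded_clinear_ops"
    and commute: "\<And>i j. i \<in> {1..d} \<Longrightarrow> j \<in> {1..d} \<Longrightarrow>
      cadjoint (W j) o\<^sub>L W i = W i o\<^sub>L cadjoint (W j)"
  shows "(\<exists>\<Phi>\<in>Hinf. (\<forall>i\<in>{1..d}. \<Phi> (lam i) = W i) \<and> Hinf_norm \<Phi> \<le> 1) \<longleftrightarrow>
    block_positive d
      (\<lambda>i j. (1 / (1 - cnj (lam i) * lam j)) *\<^sub>C (id_blinfun - (cadjoint (W i) o\<^sub>L W j)))"
proof
  assume "\<exists>\<Phi>\<in>Hinf. (\<forall>i\<in>{1..d}. \<Phi> (lam i) = W i) \<and> Hinf_norm \<Phi> \<le> 1"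
  then obtain \<Phi> where \<Phi>: "\<Phi> \<in> Hinf" "\<And>i. i \<in> {1..d} \<Longrightarrow> \<Phi> (lam i) = W i" "Hinf_norm \<Phi> \<le> 1"
    by blast
  from \<Phi>(1) obtain A where A: "\<And>n. A n \<in> bounded_clinear_ops"
    "\<And>z. z \<in> ball 0 1 \<Longrightarrow> (\<lambda>n. z ^ n *\<^sub>C A n) sums \<Phi> z" and bdd: "bounded (\<Phi> ` ball 0 1)"
    unfolding Hinf_def by blast
  have "bdd_above ((\<lambda>z. norm (\<Phi> z)) ` ball 0 1)"
    using bdd unfolding bounded_iff by (auto intro: bdd_aboveI2)
  then have le1: "norm (\<Phi> z) \<le> 1" if "z \<in> ball 0 1" for z
    using cSUP_upper[OF that] \<Phi>(3) order_trans unfolding Hinf_norm_def by blast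
  show "block_positive d
      (\<lambda>i j. (1 / (1 - cnj (lam i) * lam j)) *\<^sub>C (id_blinfun - (cadjoint (W i) o\<^sub>L W j)))"
    by (intro contractive_interpolant_imp_pick_positive[where A = A and \<Phi> = \<Phi>]
        nodes targets A le1 \<Phi>(2))
next
  assume "block_positive d
      (\<lambda>i j. (1 / (1 - cnj (lam i) * lam j)) *\<^sub>C (id_blinfun - (cadjoint (W i) o\<^sub>L W j)))"
  then obtain \<Phi> where \<Phi>: "\<Phi> \<in> Hinf" "\<And>z. z \<in> ball 0 1 \<Longrightarrow> norm (\<Phi> z) \<le> 1"
    "\<And>i. i \<in> {1..d} \<Longrightarrow> \<Phi> (lam i) = W i"
    using pick_positive_imp_contractive_interpolant[of d lam W, OF nodes targets] by blast
  have "Hinf_norm \<Phi> \<le> 1"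
    unfolding Hinf_norm_def by (rule cSUP_least) (use \<Phi>(2) in auto)
  then show "\<exists>\<Phi>\<in>Hinf. (\<forall>i\<in>{1..d}. \<Phi> (lam i) = W i) \<and> Hinf_norm \<Phi> \<le> 1"
    using \<Phi> by blast
qed

end
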